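(* Let $n\equiv 1\pmod 4$ be a positive integer and let $a$ be an indeterminate. Then, modulo $[n]_{q^2}(1-aq^{2n})(a-q^{2n})$, \[ \sum_{k=0}^{(n-1)/4}[8k+1]_{q^2}[8k+1]^2\frac{(q^2;q^8)_k^2(aq^2;q^8)_k(q^2/a;q^8)_k}{(q^8;q^8)_k^2(aq^8;q^8)_k(q^8/a;q^8)_k}q^{-4k} \equiv [n]_{q^2}\frac{(q^4;q^8)_{(n-1)/4}}{(q^8;q^8)_{(n-1)/4}}q^{-(n-1)/2}\left(1-\frac{(1-aq^2)(1-q^2/a)}{(1-q)^2(1+q^2)}\right). \]
   Context: For an indeterminate $q$, $(x;q)_k=(1-x)(1-xq)\cdots(1-xq^{k-1})$ (with $(x;q)_0=1$). For an integer $m$, $[m]=(1-q^m)/(1-q)$ and $[m]_{q^2}=(1-q^{2m})/(1-q^2)$. A congruence $A\equiv B\pmod{P}$ between rational functions in $q$ and $a$ means that $A-B$, written as a quotient of polynomials with denominator coprime to $P$, has numerator divisible by $P$. *)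

theory Defs
  imports "HOL-Computational_Algebra.Polynomial" "HOL-Computational_Algebra.Fraction_Field"
begin

text \<open>Bivariate polynomials over the rationals: the outer variable is a, the
  coefficients are univariate polynomials in q.  Rational functions in q and a
  are elements of the fraction field.\<close>

type_synonym bpoly = "rat poly poly"
type_synonym rfun = "bpoly fract"

definition qv :: bpoly where "qv = [:[:0, 1:]:]"
definition av :: bpoly where "av = [:0, 1:]"

definition qR :: rfun where "qR = Fract qv 1"
definition aR :: rfun where "aR = Fract av 1"

definition qpoch :: "'b::comm_ring_1 \<Rightarrow> 'b \<Rightarrow> nat \<Rightarrow> 'b" where
  "qpoch x q k = (\<Prod>i<k. 1 - x * q ^ i)"

definition qint :: "'b::field \<Rightarrow> nat \<Rightarrow> 'b" where
  "qint q m = (1 - q ^ m) / (1 - q)"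

definition rcong :: "rfun \<Rightarrow> rfun \<Rightarrow> bpoly \<Rightarrow> bool" where
  "rcong A B P \<longleftrightarrow> (\<exists>N D. D \<noteq> 0 \<and> coprime D P \<and> P dvd N \<and> A - B = Fract N D)"

end

(* Write Q = q^2 and p = Q^4.  The weight [8k+1]^2 is removed first: up to a telescoping boundary
   term, which carries the factor (1 - Q^n)^2 (1 - a Q^n)(1 - Q^n / a), the left-hand side is the
   last factor of the right-hand side times a truncated very-well-poised 6phi5 sum (base_sum).

   A truncated 6phi5 sum is a terminating 8phi7 sum, so Watson's transformation applies to it.  Used
   with the numerator parameters aQ, Q/a it produces terms that all contain [n] times a ratio of
   q-factorials without poles at the divisors of [n].  Used with Q, aQ it produces terms that,
   except for the first, contain 1 - Q^n / a; the first one reduces to the closed form modulo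
   a - Q^n.  The symmetry a -> 1/a gives the modulus 1 - a Q^n, and the three moduli are pairwise
   coprime. *)
theory Submission
  imports Defs "HOL-Computational_Algebra.Field_as_Ring" "HOL-Computational_Algebra.Polynomial_Factorial"
begin

section \<open>A truncated form of Watson's transformation\<close>

text \<open>The obstacle is a composite n: then [n] can share factors with single terms of
  (q^8;q^8)_k, so these cannot be inverted modulo [n]. What is integral there is a quotient (1 -
  Q^i) / (1 - Q^j) with gcd(j, n) dividing i. The form of Watson's transformation with numerator
  parameters aQ, Q/a allows all q-factorials to be paired into such quotients, and modulo [n] both
  sides of the congruence simply vanish. In that form, however, no summand displays 1 - Q^n / a;
  this factor appears once Q/a is the parameter that enters the prefactor. The moduli a - Q^n and 1
  - a Q^n are prime to every nonzero polynomial in q alone, so there the denominators in q cause no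
  trouble.

  The last factor of the right-hand side has a simple origin. With x = Q^(4k), the weight is (1 - q
  x)^2 = 1 - 2 q x + Q x^2, up to a constant. A well-poised telescoping sum has a weight
  proportional to 1 + Q x^2 plus a multiple of x. The two differ by a multiple of x only; its
  coefficient is that last factor, and x turns q^(-4k) into Q^(2k), the argument of the 6phi5
  series.\<close>

lemma qpoch_0 [simp]: "qpoch x q 0 = 1"
  by (simp add: qpoch_def)

lemma qpoch_Suc: "qpoch x q (Suc k) = qpoch x q k * (1 - x * q ^ k)"
  by (simp add: qpoch_def)

lemma qpoch_Suc_left: "qpoch x q (Suc k) = (1 - x) * qpoch (x * q) q k"
  by (simp add: qpoch_def prod.lessThan_Suc_shift mult.assoc del: prod.lessThan_Suc)

lemma qpoch_nonzero:
  fixes x :: "'b::field"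
  assumes "\<And>i. i < k \<Longrightarrow> x * q ^ i \<noteq> 1"
  shows "qpoch x q k \<noteq> 0"
  using assms by (auto simp: qpoch_def)

text \<open>With \<open>J\<close> = p^j, \<open>Y\<close> = p^(m-j) and \<open>g\<close> = f p, this
  is the telescoping relation for Watson's sum after removal of the common factor: the two terms on
  the right belong to the certificate and to its shift.\<close>

lemma watson_certificate_identity:
  fixes d e B g J Y :: "'b::comm_ring_1"
  shows "(1 - d*e*B*J*Y) * (1 - g*J*Y) * (1 - B*Y) - (1 - e*B*J*Y) * (1 - d*B*J*Y) * (1 - g*Y)
    = Y * (1 - J) * (g - d*e*B*J) * (1 - B*Y) - Y * B * (1 - d*J) * (1 - e*J) * (1 - g*Y)"
  by (simp add: algebra_simps)

text \<open>Watson's transformation of the terminating 8phi7 series with parameters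
  \<open>A; d, e, f, h, p^-m\<close> at \<open>h = A p^(m+1)\<close>, where \<open>h\<close> and \<open>p^-m\<close> cancel each other; here
  \<open>B = A p / (d e)\<close> and \<open>H = A p / f\<close>.  Increasing \<open>m\<close> by one changes the right-hand summand by a
  difference \<open>G m (j + 1) - G m j\<close>.\<close>
lemma truncated_watson:
  fixes p A d e f B H :: "'b::field" and m :: nat
  assumes A: "A * p = d * e * B" and H: "f * H = d * e * B"
    and ne: "f \<noteq> 0" "A \<noteq> 1"
      "\<And>i. p * p ^ i \<noteq> 1" "\<And>i. e * B * p ^ i \<noteq> 1" "\<And>i. d * B * p ^ i \<noteq> 1"
      "\<And>i. H * p ^ i \<noteq> 1" "\<And>i. f * p * p ^ i \<noteq> 1"
  shows "(\<Sum>k\<le>m. (1 - A * (p ^ k)^2) / (1 - A)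
            * (qpoch A p k * qpoch d p k * qpoch e p k * qpoch f p k)
            / (qpoch p p k * qpoch (e*B) p k * qpoch (d*B) p k * qpoch H p k) * (B / f) ^ k)
    = qpoch (A * p) p m * qpoch (f * p) p m / (qpoch (e*B) p m * qpoch (d*B) p m)
      * (\<Sum>j\<le>m. qpoch B p (m - j) / qpoch (f * p) p (m - j)
            * (qpoch d p j * qpoch e p j / (qpoch p p j * qpoch H p j) * (B / f) ^ j))"
proof -
  define U where "U m = qpoch (A * p) p m * qpoch (f * p) p m / (qpoch (e*B) p m * qpoch (d*B) p m)" for m
  define V where "V i = qpoch B p i / qpoch (f * p) p i" for i
  define X where "X j = qpoch d p j * qpoch e p j / (qpoch p p j * qpoch H p j) * (B / f) ^ j" for j
  define t where "t k = (1 - A * (p ^ k)^2) / (1 - A)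
            * (qpoch A p k * qpoch d p k * qpoch e p k * qpoch f p k)
            / (qpoch p p k * qpoch (e*B) p k * qpoch (d*B) p k * qpoch H p k) * (B / f) ^ k" for k
  define Z where "Z m = (1 - e * B * p ^ m) * (1 - d * B * p ^ m)" for m
  \<comment> \<open>\<open>G\<close> is the certificate; its factor \<open>1 - p ^ j\<close> makes
    it vanish at j = 0. \<open>G'\<close> is the shift of \<open>G\<close> by one, with X (j+1) / X
    j worked in so that everything is expressed at j.\<close>
  define G where "G m j = - (p ^ (Suc m - j) * (1 - p ^ j) * (f - A * p ^ j)) * (U m / Z m) * V (Suc m - j) * X j" for m j
  define G' where "G' m j = - (p ^ (m - j) * B * (1 - d * p ^ j) * (1 - e * p ^ j)) * (U m / Z m) * V (m - j) * X j" for m j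
  have Z0: "Z m \<noteq> 0" for m using ne(4,5)[of m] by (simp add: Z_def)
  have U: "U (Suc m) = U m * (1 - d * e * B * p ^ m) * (1 - f * p * p ^ m) / Z m" for m
    by (simp add: U_def qpoch_Suc Z_def A mult_ac)
  have V: "V (Suc i) = V i * (1 - B * p ^ i) / (1 - f * p * p ^ i)" for i
    by (simp add: V_def qpoch_Suc)
  have X: "X (Suc j) = X j * ((1 - d * p ^ j) * (1 - e * p ^ j)) * B / ((1 - p * p ^ j) * (1 - H * p ^ j) * f)" for j
    by (simp add: X_def qpoch_Suc mult_ac)
  have step: "U (Suc m) * (V (Suc m - j) * X j) - U m * (V (m - j) * X j) = G' m j - G m j"
    if "j \<le> m" for m j
  proof -
    define Y where "Y = p ^ (m - j)"
    define J where "J = p ^ j"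
    have M: "p ^ m = J * Y" unfolding J_def Y_def using that by (simp flip: power_add)
    have s: "Suc m - j = Suc (m - j)" using that by simp
    have g: "1 - f * p * Y \<noteq> 0" using ne(7)[of "m - j"] by (simp add: Y_def)
    define K where "K = U m * V (m - j) * X j / (Z m * (1 - f * p * Y))"
    have K: "U m * V (m - j) * X j = K * (Z m * (1 - f * p * Y))"
      using g Z0[of m] by (simp add: K_def)
    have "U (Suc m) * (V (Suc m - j) * X j)
      = K * ((1 - d*e*B*J*Y) * (1 - f*p*J*Y) * (1 - B*Y))"
      unfolding s U V K_def M by (simp add: Y_def[symmetric] mult_ac)
    moreover have "U m * (V (m - j) * X j) = K * ((1 - e*B*J*Y) * (1 - d*B*J*Y) * (1 - f*p*Y))"
      using K by (simp add: Z_def M mult_ac)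
    moreover have "G' m j = - K * (Y * B * (1 - d*J) * (1 - e*J) * (1 - f*p*Y))"
      using g by (simp add: G'_def K_def Y_def[symmetric] J_def[symmetric] mult_ac)
    moreover have "G m j = - K * (Y * (1 - J) * (f*p - d*e*B*J) * (1 - B*Y))"
    proof -
      have "G m j = - K * (Y * (1 - J) * (p * (f - A * J)) * (1 - B*Y))"
        unfolding G_def s V K_def by (simp add: Y_def[symmetric] J_def[symmetric] mult_ac)
      also have "p * (f - A * J) = f*p - d*e*B*J" unfolding A[symmetric] by (simp add: algebra_simps)
      finally show ?thesis .
    qed
    ultimately show ?thesis
      using arg_cong[OF watson_certificate_identity[of d e B J Y "f*p"], of "\<lambda>u. K * u"]
      by (simp only: right_diff_distrib[of K]) simp
  qed
  have GG: "G m (Suc j) = G' m j" if "j \<le> m" for m j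
  proof -
    have pp: "1 - p * p ^ j \<noteq> 0" "1 - H * p ^ j \<noteq> 0" using ne(3,6)[of j] by auto
    \<comment> \<open>This factor of \<open>G\<close> cancels the denominator
      \<open>1 - H * p ^ j\<close> that \<open>X (Suc j)\<close> introduces.\<close>
    have "(f - A * p ^ Suc j) = f * (1 - H * p ^ j)"
      using A H by (simp add: algebra_simps)
    then have "G m (Suc j) = - (p ^ (m - j) * (1 - p * p ^ j) * (f * (1 - H * p ^ j))) * (U m / Z m)
        * V (m - j) * (X j * ((1 - d * p ^ j) * (1 - e * p ^ j)) * B / ((1 - p * p ^ j) * (1 - H * p ^ j) * f))"
      by (simp add: G_def X)
    also have "\<dots> = G' m j"
      using pp ne(1) by (simp add: G'_def)
    finally show ?thesis .
  qed
  \<comment> \<open>The right-hand sum for m + 1 has the extra summand j = m + 1, outside the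
    telescoping range. Together with the upper boundary value of \<open>G\<close> it is exactly the
    new summand on the left.\<close>
  have last: "G m (Suc m) + U (Suc m) * (V 0 * X (Suc m)) = t (Suc m)" for m
  proof -
    define z where "z = p ^ Suc m"
    define K where "K = U m / Z m * X (Suc m)"
    have Az: "A * z = d * e * B * p ^ m" by (simp add: z_def flip: A)
    have V0: "V 0 = 1" by (simp add: V_def)
    have "G m (Suc m) = - K * ((1 - z) * (f - A * z))"
      by (simp add: G_def K_def z_def V0)
    moreover have "U (Suc m) * (V 0 * X (Suc m)) = K * ((1 - A * z) * (1 - f * z))"
      unfolding Az by (simp add: U K_def z_def V0 mult_ac)
    moreover have "t (Suc m) = K * ((1 - f) * (1 - A * z^2))"
    proof -
      have "t (Suc m) = (1 - A * z^2) / (1 - A)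
            * (((1 - A) * qpoch (A*p) p m) * qpoch d p (Suc m) * qpoch e p (Suc m) * ((1 - f) * qpoch (f*p) p m))
            / (qpoch p p (Suc m) * (qpoch (e*B) p m * (1 - e * B * p ^ m)) * (qpoch (d*B) p m * (1 - d * B * p ^ m)) * qpoch H p (Suc m)) * (B / f) ^ Suc m"
        by (simp only: t_def z_def qpoch_Suc_left[of A] qpoch_Suc_left[of f] qpoch_Suc[of "e*B"] qpoch_Suc[of "d*B"])
      also have "\<dots> = K * ((1 - f) * (1 - A * z^2))"
        unfolding K_def U_def Z_def X_def using ne(2) by (simp add: mult_ac)
      finally show ?thesis .
    qed
    moreover have "(1 - A * z) * (1 - f * z) - (1 - z) * (f - A * z) = (1 - f) * (1 - A * z^2)"
      by (simp add: algebra_simps power2_eq_square)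
    ultimately show ?thesis
      by (metis (no_types, opaque_lifting) add.commute minus_mult_left right_diff_distrib uminus_add_conv_diff)
  qed
  have "(\<Sum>k\<le>m. t k) = (\<Sum>j\<le>m. U m * (V (m - j) * X j))"
  proof (induction m)
    case 0
    show ?case using ne(2) by (simp add: t_def U_def V_def X_def)
  next
    case (Suc m)
    have "(\<Sum>j\<le>m. U (Suc m) * (V (Suc m - j) * X j)) - (\<Sum>j\<le>m. U m * (V (m - j) * X j))
      = (\<Sum>j\<le>m. G m (Suc j) - G m j)"
      unfolding sum_subtractf[symmetric] by (intro sum.cong) (simp_all add: step GG)
    also have "\<dots> = G m (Suc m) - G m 0"
      by (rule sum_lessThan_telescope[of "G m" "Suc m", unfolded lessThan_Suc_atMost])
    also have "G m 0 = 0"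
      by (simp add: G_def)
    finally show ?case using Suc last[of m] by (simp add: algebra_simps)
  qed
  then show ?thesis
    by (simp add: t_def U_def V_def X_def sum_distrib_left)
qed

text \<open>The two shifted products have a difference divisible by \<open>1 - A x^2\<close> (with \<open>x = p^k\<close>), because
  \<open>x \<mapsto> 1 / (A x)\<close> exchanges them up to a power of \<open>x\<close>; the last factor is the quotient.\<close>
lemma wellpoised_telescope:
  fixes p A b :: "'b::field" and m :: nat
  assumes b: "b \<noteq> 0" and A: "A \<noteq> 0"
    and ne: "\<And>i. p * p ^ i \<noteq> 1" "\<And>i. b * p * p ^ i \<noteq> 1" "\<And>i. p / b * p ^ i \<noteq> 1"
  defines "w \<equiv> \<lambda>k. (qpoch A p k)^2 * qpoch (b*A) p k * qpoch (A/b) p k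
                / ((qpoch p p k)^2 * qpoch (b*p) p k * qpoch (p/b) p k) / A ^ (2*k)"
  shows "(\<Sum>k\<le>m. (1 - A * (p^k)^2) * w k
            * ((1 - A^2) * (1 + A * (p^k)^2) - A * (1 - A) * (2 + b + 1/b) * p^k))
       = w m * ((1 - A * p^m)^2 * (1 - b*A*p^m) * (1 - A/b*p^m))"
proof (induction m)
  case 0
  show ?case using b by (simp add: w_def) (simp add: field_simps power2_eq_square power4_eq_xxxx)
next
  case (Suc m)
  define x where "x = p * p ^ m"
  define y z where "y = p / b * p ^ m" and "z = b * p * p ^ m"
  have n: "1 - x \<noteq> 0" "1 - z \<noteq> 0" "1 - y \<noteq> 0" using ne[of m] by (auto simp: x_def y_def z_def)
  have yz: "y = x / b" "z = b * x" by (simp_all add: x_def y_def z_def)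
  \<comment> \<open>\<open>A^2\<close> comes from the power \<open>A ^ (2*k)\<close> in
    \<open>w\<close>. With the old boundary term written through \<open>w (Suc m)\<close>, the
    induction step becomes an identity in \<open>x\<close>, \<open>A\<close>, \<open>b\<close> and
    1/b.\<close>
  have "w m * ((1 - A * p^m)^2 * (1 - b*A*p^m) * (1 - A/b*p^m))
      = w (Suc m) * (A^2 * (1 - x)^2 * (1 - z) * (1 - y))"
    unfolding w_def qpoch_Suc x_def[symmetric] y_def[symmetric] z_def[symmetric]
    using n A by (simp add: power_mult_distrib power2_eq_square mult_ac)
  then have w: "w m * ((1 - A * p^m)^2 * (1 - b*A*p^m) * (1 - A/b*p^m))
      = w (Suc m) * (A^2 * (1 - x)^2 * (1 - b * x) * (1 - x / b))"
    by (simp only: yz)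
  have "A^2 * (1 - x)^2 * (1 - b * x) * (1 - x / b)
     + (1 - A * x^2) * ((1 - A^2) * (1 + A * x^2) - A * (1 - A) * (2 + b + 1/b) * x)
     = (1 - A * x)^2 * (1 - b*A*x) * (1 - A/b*x)"
    using b by (simp add: field_simps power2_eq_square)
  from arg_cong[OF this, of "\<lambda>u. w (Suc m) * u"]
  show ?case
    unfolding sum.atMost_Suc Suc w by (simp add: x_def distrib_left mult_ac)
qed

section \<open>Congruences between rational functions\<close>

text \<open>The localisation of the polynomial ring at the elements prime to \<open>P\<close>, for
  arbitrary and possibly reducible \<open>P\<close>. Congruence modulo \<open>P\<close> is
  congruence modulo the ideal generated by \<open>P\<close> in this ring.\<close>

definition integral_at :: "bpoly \<Rightarrow> rfun \<Rightarrow> bool" where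
  "integral_at P X \<longleftrightarrow> (\<exists>N D. D \<noteq> 0 \<and> coprime D P \<and> X = Fract N D)"

text \<open>The units of that ring. Zero has to be excluded explicitly because
  \<open>1 / 0 = 0\<close> is integral.\<close>

definition unit_at :: "bpoly \<Rightarrow> rfun \<Rightarrow> bool" where
  "unit_at P X \<longleftrightarrow> X \<noteq> 0 \<and> integral_at P X \<and> integral_at P (1 / X)"

lemma integral_at_to_fract [simp]: "integral_at P (to_fract N)"
  unfolding integral_at_def to_fract_def by (rule exI[of _ N], rule exI[of _ 1]) simp

lemma integral_at_0 [simp]: "integral_at P 0" and integral_at_1 [simp]: "integral_at P 1"
  using integral_at_to_fract[of P 0] integral_at_to_fract[of P 1] by simp_all

lemma integral_at_add: "integral_at P X \<Longrightarrow> integral_at P Y \<Longrightarrow> integral_at P (X + Y)"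
proof -
  assume "integral_at P X" "integral_at P Y"
  then obtain N D N' D' where *: "D \<noteq> 0" "coprime D P" "X = Fract N D" "D' \<noteq> 0" "coprime D' P" "Y = Fract N' D'"
    unfolding integral_at_def by blast
  then have "X + Y = Fract (N * D' + N' * D) (D * D')" by simp
  moreover have "D * D' \<noteq> 0" "coprime (D * D') P" using * by simp_all
  ultimately show ?thesis unfolding integral_at_def by blast
qed

lemma integral_at_mult: "integral_at P X \<Longrightarrow> integral_at P Y \<Longrightarrow> integral_at P (X * Y)"
proof -
  assume "integral_at P X" "integral_at P Y"
  then obtain N D N' D' where *: "D \<noteq> 0" "coprime D P" "X = Fract N D" "D' \<noteq> 0" "coprime D' P" "Y = Fract N' D'"
    unfolding integral_at_def by blast
  then have "X * Y = Fract (N * N') (D * D')" by simp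
  moreover have "D * D' \<noteq> 0" "coprime (D * D') P" using * by simp_all
  ultimately show ?thesis unfolding integral_at_def by blast
qed

lemma integral_at_uminus: "integral_at P X \<Longrightarrow> integral_at P (- X)"
  using integral_at_mult[of P "to_fract (-1)" X] integral_at_to_fract[of P "-1"]
  by (simp add: to_fract_uminus del: integral_at_to_fract)

lemma integral_at_diff: "integral_at P X \<Longrightarrow> integral_at P Y \<Longrightarrow> integral_at P (X - Y)"
  using integral_at_add[of P X "- Y"] integral_at_uminus[of P Y] by simp

lemma integral_at_power: "integral_at P X \<Longrightarrow> integral_at P (X ^ k)"
  by (induction k) (auto intro: integral_at_mult)

lemma integral_at_prod: "(\<And>i. i \<in> S \<Longrightarrow> integral_at P (f i)) \<Longrightarrow> integral_at P (prod f S)"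
  by (induction S rule: infinite_finite_induct) (auto intro: integral_at_mult)

lemma integral_at_sum: "(\<And>i. i \<in> S \<Longrightarrow> integral_at P (f i)) \<Longrightarrow> integral_at P (sum f S)"
  by (induction S rule: infinite_finite_induct) (auto intro: integral_at_add)

lemma unit_at_to_fract: "D \<noteq> 0 \<Longrightarrow> coprime D P \<Longrightarrow> unit_at P (to_fract D)"
  unfolding unit_at_def integral_at_def[of P "1 / _"]
  by (intro conjI exI[of _ 1] exI[of _ D]) (auto simp: Fract_conv_to_fract)

lemma unit_at_1 [simp]: "unit_at P 1"
  by (simp add: unit_at_def)

lemma unit_at_mult: "unit_at P X \<Longrightarrow> unit_at P Y \<Longrightarrow> unit_at P (X * Y)"
  using integral_at_mult[of P X Y] integral_at_mult[of P "1 / X" "1 / Y"]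
  by (auto simp: unit_at_def)

lemma unit_at_divide: "unit_at P X \<Longrightarrow> unit_at P Y \<Longrightarrow> unit_at P (X / Y)"
  using integral_at_mult[of P X "1 / Y"] integral_at_mult[of P Y "1 / X"]
  by (auto simp: unit_at_def)

lemma unit_at_power: "unit_at P X \<Longrightarrow> unit_at P (X ^ k)"
  by (induction k) (auto intro: unit_at_mult)

lemma unit_at_prod: "(\<And>i. i \<in> S \<Longrightarrow> unit_at P (f i)) \<Longrightarrow> unit_at P (prod f S)"
  by (induction S rule: infinite_finite_induct) (auto intro: unit_at_mult)

lemma unit_at_integral: "unit_at P X \<Longrightarrow> integral_at P X"
  by (simp add: unit_at_def)

lemma unit_at_nonzero: "unit_at P X \<Longrightarrow> X \<noteq> 0"
  by (simp add: unit_at_def)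

lemma integral_at_divide: "integral_at P X \<Longrightarrow> unit_at P Y \<Longrightarrow> integral_at P (X / Y)"
  using integral_at_mult[of P X "1 / Y"] by (simp add: unit_at_def)

lemma rcong_iff_integral: "rcong A B P \<longleftrightarrow> (\<exists>X. integral_at P X \<and> A - B = to_fract P * X)"
proof
  assume "rcong A B P"
  then obtain N D where "D \<noteq> 0" "coprime D P" "P dvd N" "A - B = Fract N D"
    unfolding rcong_def by blast
  moreover from this obtain k where "N = P * k" by blast
  ultimately show "\<exists>X. integral_at P X \<and> A - B = to_fract P * X"
    unfolding integral_at_def by (intro exI[of _ "Fract k D"]) (auto simp: Fract_conv_to_fract)
next
  assume "\<exists>X. integral_at P X \<and> A - B = to_fract P * X"
  then obtain N D where "D \<noteq> 0" "coprime D P" "A - B = to_fract P * Fract N D"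
    unfolding integral_at_def by blast
  then show "rcong A B P"
    unfolding rcong_def
    by (intro exI[of _ "P * N"] exI[of _ D]) (simp add: Fract_conv_to_fract)
qed

lemma rcongI: "integral_at P X \<Longrightarrow> A - B = to_fract P * X \<Longrightarrow> rcong A B P"
  unfolding rcong_iff_integral by (intro exI conjI)

lemma rcong_refl [simp]: "rcong A A P"
proof -
  have "integral_at P 0 \<and> A - A = to_fract P * 0" by simp
  then show ?thesis unfolding rcong_iff_integral by (rule exI)
qed

lemma rcong_add:
  assumes "rcong A B P" "rcong A' B' P"
  shows "rcong (A + A') (B + B') P"
proof -
  obtain X where X: "integral_at P X" "A - B = to_fract P * X"
    using assms(1) unfolding rcong_iff_integral by (elim exE conjE)
  obtain Y where Y: "integral_at P Y" "A' - B' = to_fract P * Y"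
    using assms(2) unfolding rcong_iff_integral by (elim exE conjE)
  have "integral_at P (X + Y) \<and> A + A' - (B + B') = to_fract P * (X + Y)"
    using X Y by (simp add: integral_at_add distrib_left add_diff_add)
  then show ?thesis unfolding rcong_iff_integral by (rule exI)
qed

lemma rcong_mult_right:
  assumes "rcong A B P" "integral_at P C"
  shows "rcong (A * C) (B * C) P"
proof -
  obtain X where X: "integral_at P X" "A - B = to_fract P * X"
    using assms(1) unfolding rcong_iff_integral by (elim exE conjE)
  have "integral_at P (X * C) \<and> A * C - B * C = to_fract P * (X * C)"
    using X assms(2) by (simp add: integral_at_mult mult.assoc flip: left_diff_distrib)
  then show ?thesis unfolding rcong_iff_integral by (rule exI)
qed

lemma rcong_diff_0_iff: "rcong (A - B) 0 P \<longleftrightarrow> rcong A B P"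
  by (simp add: rcong_def)

lemma rcong_trans:
  assumes "rcong A B P" "rcong B C P"
  shows "rcong A C P"
  using rcong_add[of "A - B" 0 P "B - C" 0] assms by (simp add: rcong_diff_0_iff)

lemma rcong_sym: "rcong A B P \<Longrightarrow> rcong B A P"
  using rcong_mult_right[of "A - B" 0 P "-1"] integral_at_uminus[of P 1] rcong_diff_0_iff[of B A]
  by (simp add: rcong_diff_0_iff)

lemma rcong_mult:
  assumes "rcong A B P" "rcong A' B' P" "integral_at P A'" "integral_at P B"
  shows "rcong (A * A') (B * B') P"
proof (rule rcong_trans)
  show "rcong (A * A') (B * A') P" by (rule rcong_mult_right[OF assms(1,3)])
  show "rcong (B * A') (B * B') P" using rcong_mult_right[OF assms(2,4)] by (simp add: mult.commute)
qed

lemma rcong_sum: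
  "(\<And>i. i \<in> S \<Longrightarrow> rcong (f i) (g i) P) \<Longrightarrow> rcong (sum f S) (sum g S) P"
  by (induction S rule: infinite_finite_induct) (auto intro: rcong_add)

lemma rcong_prod:
  assumes "\<And>i. i \<in> S \<Longrightarrow> rcong (f i) (g i) P \<and> integral_at P (f i) \<and> integral_at P (g i)"
  shows "rcong (prod f S) (prod g S) P"
  using assms
  by (induction S rule: infinite_finite_induct) (auto intro!: rcong_mult integral_at_prod)

lemma rcong_0_integral_mult: "rcong A 0 P \<Longrightarrow> integral_at P C \<Longrightarrow> rcong (A * C) 0 P"
  using rcong_mult_right[of A 0 P C] by simp

text \<open>Lowest terms: a denominator prime to each of the two moduli may be taken to be the reduced
  one, which divides both given denominators.\<close>
lemma rcong_coprime_mult: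
  assumes "rcong A B P" "rcong A B P'" "coprime P P'"
  shows "rcong A B (P * P')"
proof -
  define N D where "N = fst (quot_of_fract (A - B))" and "D = snd (quot_of_fract (A - B))"
  have D: "D \<noteq> 0" "coprime N D" by (simp_all add: N_def D_def coprime_quot_of_fract)
  have ND: "A - B = Fract N D" by (simp add: N_def D_def Fract_quot_of_fract)
  have red: "coprime D R \<and> R dvd N" if R: "rcong A B R" for R
  proof -
    obtain N' D' where *: "D' \<noteq> 0" "coprime D' R" "R dvd N'" "A - B = Fract N' D'"
      using R unfolding rcong_def by blast
    have "Fract N D = Fract N' D'" using ND *(4) by (rule trans[OF sym])
    then have eq: "N * D' = N' * D" using D(1) *(1) by (simp add: eq_fract)
    have "D dvd N * D'" unfolding eq by simp
    moreover have "coprime D N" using D(2) by (rule coprime_imp_coprime) auto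
    ultimately have "D dvd D'" by (simp add: coprime_dvd_mult_right_iff)
    then have "coprime D R" using *(2) by (rule coprime_divisors[OF _ dvd_refl])
    have "R dvd N * D'" using *(3) eq by simp
    moreover have "coprime R D'" using *(2) by (rule coprime_imp_coprime) auto
    ultimately have "R dvd N" by (simp add: coprime_dvd_mult_left_iff)
    with \<open>coprime D R\<close> show ?thesis ..
  qed
  from red[OF assms(1)] red[OF assms(2)] show ?thesis
    unfolding rcong_def using D(1) ND assms(3)
    by (intro exI[of _ N] exI[of _ D]) (simp add: divides_mult)
qed

text \<open>A divisor of a nonzero polynomial in q alone is free of a by degree, so it divides every
  coefficient of \<open>g\<close>; one coefficient that is a nonzero rational makes it a
  unit.\<close>

lemma coprime_const_poly:
  fixes u :: "rat poly" and g :: bpoly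
  assumes "u \<noteq> 0" "is_unit (coeff g i)"
  shows "coprime [:u:] g"
proof (rule coprimeI)
  fix c assume c: "c dvd [:u:]" "c dvd g"
  have "degree c \<le> degree [:u:]" using c(1) assms(1) by (intro dvd_imp_degree_le) auto
  then obtain v where v: "c = [:v:]" using degree_eq_zeroE by auto
  then have "v dvd coeff g i" using c(2) by (simp add: const_poly_dvd_iff)
  then have "is_unit v" using assms(2) by (rule dvd_trans)
  then show "is_unit c" using v by (simp add: is_unit_const_poly_iff)
qed

text \<open>Elimination of a: a common divisor of \<open>f\<close> and \<open>g\<close> divides the
  remaining polynomial \<open>u\<close> in q, which is prime to \<open>f\<close>.\<close>

lemma coprime_of_const_combination:
  fixes f g x y :: bpoly
  assumes "x * f + y * g = [:u:]" "u \<noteq> 0" "is_unit (coeff f i)"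
  shows "coprime f g"
proof (rule coprimeI)
  fix c assume c: "c dvd f" "c dvd g"
  then have "c dvd [:u:]" unfolding assms(1)[symmetric] by simp
  then show "is_unit c" using c(1) coprime_const_poly[OF assms(2,3)] coprime_common_divisor by blast
qed

section \<open>Reduction to a truncated very-well-poised sum\<close>

text \<open>The 6phi5 series with A = Q, parameters Q, bQ, Q/b and base p = Q^4, truncated after k =
  m. Its argument is A p / (d e f) = Q^2. One of the two factors \<open>qpoch Q\<close> is that of
  A.\<close>

definition base_sum :: "'b::field \<Rightarrow> 'b \<Rightarrow> nat \<Rightarrow> 'b" where
  "base_sum Q b m = (\<Sum>k\<le>m. (1 - Q * ((Q^4) ^ k)^2) / (1 - Q)
      * ((qpoch Q (Q^4) k)^2 * qpoch (b*Q) (Q^4) k * qpoch (Q/b) (Q^4) k)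
      / ((qpoch (Q^4) (Q^4) k)^2 * qpoch (b*Q^4) (Q^4) k * qpoch (Q^4/b) (Q^4) k) * (Q^2) ^ k)"

text \<open>Nonvanishing of all denominators, in a form symmetric under b -> 1/b.\<close>

definition generic :: "'b::field \<Rightarrow> 'b \<Rightarrow> bool" where
  "generic Q b \<longleftrightarrow> Q \<noteq> 0 \<and> b \<noteq> 0 \<and> (\<forall>i>0. Q ^ i \<noteq> 1 \<and> b * Q ^ i \<noteq> 1 \<and> Q ^ i / b \<noteq> 1)"

lemma genericD:
  assumes "generic Q b"
  shows "Q \<noteq> 0" "b \<noteq> 0" "Q \<noteq> 1" "Suc 0 \<le> i \<Longrightarrow> Q ^ i \<noteq> 1" "Suc 0 \<le> i \<Longrightarrow> b * Q ^ i \<noteq> 1"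
    "Suc 0 \<le> i \<Longrightarrow> Q ^ i / b \<noteq> 1"
    "Suc 0 \<le> i \<Longrightarrow> Q ^ i * (Q^4) ^ j \<noteq> 1" "Suc 0 \<le> i \<Longrightarrow> b * Q ^ i * (Q^4) ^ j \<noteq> 1"
    "Suc 0 \<le> i \<Longrightarrow> Q ^ i / b * (Q^4) ^ j \<noteq> 1"
proof -
  have *: "0 < k \<Longrightarrow> Q ^ k \<noteq> 1 \<and> b * Q ^ k \<noteq> 1 \<and> Q ^ k / b \<noteq> 1" for k
    using assms by (auto simp: generic_def)
  have e: "Q ^ i * (Q^4) ^ j = Q ^ (i + 4 * j)" by (simp add: power_add power_mult)
  show "Q \<noteq> 0" "b \<noteq> 0" using assms by (auto simp: generic_def)
  show "Q \<noteq> 1" using *[of 1] by simp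
  show "Suc 0 \<le> i \<Longrightarrow> Q ^ i \<noteq> 1" "Suc 0 \<le> i \<Longrightarrow> b * Q ^ i \<noteq> 1"
    "Suc 0 \<le> i \<Longrightarrow> Q ^ i / b \<noteq> 1" using *[of i] by auto
  show "Suc 0 \<le> i \<Longrightarrow> Q ^ i * (Q^4) ^ j \<noteq> 1" "Suc 0 \<le> i \<Longrightarrow> b * Q ^ i * (Q^4) ^ j \<noteq> 1"
    "Suc 0 \<le> i \<Longrightarrow> Q ^ i / b * (Q^4) ^ j \<noteq> 1"
    using *[of "i + 4 * j"] unfolding times_divide_eq_left mult.assoc[of b] e by auto
qed

text \<open>Here f = Q, so f p = Q^5 and (Q^5;Q^4)_m occurs twice in front: one copy yields [n], the
  other cancels the denominators inside the sum.\<close>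

lemma base_sum_watson_symmetric:
  fixes Q b :: "'b::field"
  assumes "generic Q b"
  shows "base_sum Q b m = (qpoch (Q^5) (Q^4) m)^2 / (qpoch (Q^4/b) (Q^4) m * qpoch (b*Q^4) (Q^4) m)
    * (\<Sum>j\<le>m. qpoch (Q^3) (Q^4) (m - j) / qpoch (Q^5) (Q^4) (m - j)
        * (qpoch (b*Q) (Q^4) j * qpoch (Q/b) (Q^4) j / (qpoch (Q^4) (Q^4) j)^2 * (Q^2) ^ j))"
proof -
  note g = genericD[OF assms]
  have 1: "Q * Q^4 = b*Q * (Q/b) * Q^3" "Q * Q^4 = Q^5" "Q/b * Q^3 = Q^4/b" "b*Q*Q^3 = b*Q^4"
    "Q^3/Q = Q^2"
    using g(1,2) by (simp_all add: eval_nat_numeral)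
  show ?thesis
    using truncated_watson[of Q "Q^4" "b*Q" "Q/b" "Q^3" Q "Q^4" m, OF 1(1)] 1(1) g(1,3) g(7)[of 4] g(7)[of 5] g(8,9)[of 4]
    unfolding 1(2-5) base_sum_def by (simp add: power2_eq_square mult_ac)
qed

text \<open>Here f = Q/b, so (Q^5/b;Q^4)_m stands in front. For m > 0 its last factor is 1 -
  Q^(4m+1)/b.\<close>

lemma base_sum_watson_asymmetric:
  fixes Q b :: "'b::field"
  assumes "generic Q b"
  shows "base_sum Q b m = qpoch (Q^5) (Q^4) m * qpoch (Q^5/b) (Q^4) m / (qpoch (Q^4) (Q^4) m * qpoch (Q^4/b) (Q^4) m)
    * (\<Sum>j\<le>m. qpoch (Q^3/b) (Q^4) (m - j) / qpoch (Q^5/b) (Q^4) (m - j)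
        * (qpoch Q (Q^4) j * qpoch (b*Q) (Q^4) j / (qpoch (Q^4) (Q^4) j * qpoch (b*Q^4) (Q^4) j) * (Q^2) ^ j))"
proof -
  note g = genericD[OF assms]
  have 1: "Q * Q^4 = Q * (b*Q) * (Q^3/b)" "Q * Q^4 = Q^5" "b*Q*(Q^3/b) = Q^4" "Q*(Q^3/b) = Q^4/b"
    "Q^3/b/(Q/b) = Q^2" "Q/b * Q^4 = Q^5/b" "Q/b * (b * Q^4) = Q * (b*Q) * (Q^3/b)" "Q/b \<noteq> 0"
    using g(1,2) by (simp_all add: eval_nat_numeral)
  show ?thesis
    using truncated_watson[of Q "Q^4" Q "b*Q" "Q^3/b" "Q/b" "b * Q^4" m, OF 1(1) 1(7) 1(8)] g(1,3) g(7)[of 4] g(9)[of 5] g(8,9)[of 4]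
    unfolding 1(2-6) base_sum_def by (simp add: power2_eq_square mult_ac)
qed

definition weighted_sum :: "'b::field \<Rightarrow> 'b \<Rightarrow> nat \<Rightarrow> 'b" where
  "weighted_sum q b m = (\<Sum>k\<le>m. qint (q^2) (8*k+1) * (qint q (8*k+1))^2 *
     ((qpoch (q^2) (q^8) k)^2 * qpoch (b * q^2) (q^8) k * qpoch (q^2 / b) (q^8) k) /
     ((qpoch (q^8) (q^8) k)^2 * qpoch (b * q^8) (q^8) k * qpoch (q^8 / b) (q^8) k) / q ^ (4*k))"

definition closing_factor :: "'b::field \<Rightarrow> 'b \<Rightarrow> 'b" where
  "closing_factor q b = 1 - (1 - b * q^2) * (1 - q^2 / b) / ((1 - q)^2 * (1 + q^2))"

definition boundary :: "'b::field \<Rightarrow> 'b \<Rightarrow> nat \<Rightarrow> 'b" where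
  "boundary Q b m = (qpoch Q (Q^4) m)^2 * qpoch (b*Q) (Q^4) m * qpoch (Q/b) (Q^4) m
     / ((qpoch (Q^4) (Q^4) m)^2 * qpoch (b*Q^4) (Q^4) m * qpoch (Q^4/b) (Q^4) m) / Q ^ (2*m)
     * ((1 - Q ^ (4*m+1))^2 * (1 - b * Q ^ (4*m+1)) * (1 - Q ^ (4*m+1) / b))"

lemma weighted_sum_inverse: "weighted_sum q (1/b) m = weighted_sum q b m"
  by (simp add: weighted_sum_def mult_ac)

lemma closing_factor_inverse: "closing_factor q (1/b) = closing_factor q b"
  by (simp add: closing_factor_def mult_ac)

lemma weighted_sum_eq_base_sum:
  fixes q b :: "'b::field" and m :: nat
  defines "Q \<equiv> q^2"
  assumes g: "generic Q b" and q: "q \<noteq> 1"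
  shows "weighted_sum q b m = closing_factor q b * base_sum Q b m
      + boundary Q b m / ((1 - Q) * (1 - q)^2 * (1 - Q^2))"
proof -
  define C where "C = closing_factor q b"
  have C_def': "C = 1 - (1 - b * Q) * (1 - Q / b) / ((1 - q)^2 * (1 + Q))"
    by (simp add: C_def closing_factor_def Q_def)
  note gD = genericD[OF g]
  have q8: "q ^ 8 = Q^4" by (simp add: Q_def flip: power_mult)
  define w where "w k = (qpoch Q (Q^4) k)^2 * qpoch (b*Q) (Q^4) k * qpoch (Q/b) (Q^4) k
                / ((qpoch (Q^4) (Q^4) k)^2 * qpoch (b*Q^4) (Q^4) k * qpoch (Q^4/b) (Q^4) k) / Q ^ (2*k)" for k
  define x where "x k = (Q^4) ^ k" for k :: nat
  define c where "c = (1 - Q) * (1 - q)^2 * (1 - Q^2)"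
  have Q2: "1 - Q^2 \<noteq> 0" "1 + Q \<noteq> 0"
    using gD(3) gD(4)[of 2] by (auto simp: power2_eq_1_iff add_eq_0_iff)
  have nz: "1 - q \<noteq> 0" "1 - Q \<noteq> 0" "c \<noteq> 0" using q gD(3) Q2 by (auto simp: c_def)
  \<comment> \<open>Since \<open>Q\<close> = q^2, the coefficients of 1 and y^2 already agree with
    those of the telescoping weight. Comparing the coefficients of y determines
    \<open>C\<close>.\<close>
  have quad: "(1 - q * y)^2 / (1 - q)^2 / (1 - Q)
      = ((1 - Q^2) * (1 + Q * y^2) - Q * (1 - Q) * (2 + b + 1/b) * y) / c + C * y / (1 - Q)" for y
  proof -
    have "C * ((1 - q)^2 * (1 + Q)) = (1 - q)^2 * (1 + Q) - (1 - b * Q) * (1 - Q / b)"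
    proof -
      have "(1 - E / D) * D = D - E" if "D \<noteq> 0" for D E :: 'b
        using that by (simp add: left_diff_distrib)
      then show ?thesis unfolding C_def' using nz Q2 by simp
    qed
    also have "\<dots> = Q * (2 + b + 1/b) - 2 * q * (1 + Q)"
      using gD(2) by (simp add: field_simps Q_def power2_eq_square)
    finally have C: "C * ((1 - q)^2 * (1 + Q)) = Q * (2 + b + 1/b) - 2 * q * (1 + Q)" .
    have "C * y / (1 - Q) = C * ((1 - q)^2 * (1 + Q)) * y * (1 - Q) / c"
      using nz Q2 by (simp add: c_def field_simps power2_eq_square)
    also have "\<dots> = (Q * (2 + b + 1/b) - 2 * q * (1 + Q)) * y * (1 - Q) / c"
      by (simp only: C)
    finally have "((1 - Q^2) * (1 + Q * y^2) - Q * (1 - Q) * (2 + b + 1/b) * y) / c + C * y / (1 - Q)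
      = ((1 - Q^2) * (1 + Q * y^2) - Q * (1 - Q) * (2 + b + 1/b) * y
          + (Q * (2 + b + 1/b) - 2 * q * (1 + Q)) * y * (1 - Q)) / c"
      by (simp only: add_divide_distrib)
    also have "(1 - Q^2) * (1 + Q * y^2) - Q * (1 - Q) * (2 + b + 1/b) * y
          + (Q * (2 + b + 1/b) - 2 * q * (1 + Q)) * y * (1 - Q) = (1 - q * y)^2 * (1 - Q^2)"
      by (simp add: algebra_simps diff_divide_distrib Q_def power2_eq_square)
    finally show ?thesis using Q2 by (simp add: c_def mult_ac)
  qed
  have base: "base_sum Q b m = (\<Sum>k\<le>m. (1 - Q * (x k)^2) / (1 - Q) * w k * x k)"
  proof -
    \<comment> \<open>The extra factor \<open>x k\<close> turns Q^(-2k) in \<open>w\<close> into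
      Q^(2k), the power in \<open>base_sum\<close>.\<close>
    have "x k = Q ^ (2*k) * (Q^2)^k" for k
      by (simp add: x_def flip: power_mult power_add)
    then show ?thesis
      unfolding base_sum_def x_def[symmetric] w_def using gD(1)
      by (intro sum.cong) (simp_all add: mult_ac)
  qed
  have tele: "(\<Sum>k\<le>m. (1 - Q * (x k)^2) * w k
            * ((1 - Q^2) * (1 + Q * (x k)^2) - Q * (1 - Q) * (2 + b + 1/b) * x k))
       = w m * ((1 - Q ^ (4*m+1))^2 * (1 - b * Q ^ (4*m+1)) * (1 - Q ^ (4*m+1) / b))"
    using wellpoised_telescope[of b Q "Q^4" m] gD(1,2) gD(7-9)[of 4]
    by (simp add: w_def x_def power_mult mult.assoc)
  have "qint Q (8*k+1) * (qint q (8*k+1))^2 *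
       ((qpoch Q (q^8) k)^2 * qpoch (b * Q) (q^8) k * qpoch (Q / b) (q^8) k) /
       ((qpoch (q^8) (q^8) k)^2 * qpoch (b * q^8) (q^8) k * qpoch (q^8 / b) (q^8) k) /
       q ^ (4*k) = (1 - Q * (x k)^2) * w k * ((1 - q * x k)^2 / (1 - q)^2 / (1 - Q))" for k
  proof -
    have pow: "Q ^ (8*k+1) = Q * (x k)^2" "q ^ (8*k+1) = q * x k" "q ^ (4*k) = Q ^ (2*k)"
      by (simp_all add: x_def Q_def flip: power_mult)
    show ?thesis
      unfolding qint_def q8 w_def pow by (simp add: power_divide mult_ac)
  qed
  then have "weighted_sum q b m = (\<Sum>k\<le>m. (1 - Q * (x k)^2) * w k *
       (((1 - Q^2) * (1 + Q * (x k)^2) - Q * (1 - Q) * (2 + b + 1/b) * x k) / c + C * x k / (1 - Q)))"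
    by (simp only: weighted_sum_def quad flip: Q_def)
  also have "\<dots> = C * base_sum Q b m + (\<Sum>k\<le>m. (1 - Q * (x k)^2) * w k
            * ((1 - Q^2) * (1 + Q * (x k)^2) - Q * (1 - Q) * (2 + b + 1/b) * x k)) / c"
    unfolding base sum_distrib_left sum_divide_distrib sum.distrib[symmetric]
    by (intro sum.cong) (simp_all add: distrib_left)
  finally show ?thesis unfolding tele unfolding w_def c_def C_def boundary_def .
qed

section \<open>The sum modulo each factor\<close>

lemma rcong_of_diff:
  assumes "rcong E 0 P" "A - B = E * C" "integral_at P C"
  shows "rcong A B P"
  using rcong_0_integral_mult[OF assms(1,3)] unfolding assms(2)[symmetric] rcong_diff_0_iff .

lemma unit_at_qpoch:
  "(\<And>i. i < k \<Longrightarrow> unit_at P (1 - x * y ^ i)) \<Longrightarrow> unit_at P (qpoch x y k)"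
  unfolding qpoch_def by (rule unit_at_prod) simp

lemma integral_at_qpoch:
  "integral_at P x \<Longrightarrow> integral_at P y \<Longrightarrow> integral_at P (qpoch x y k)"
  unfolding qpoch_def by (intro integral_at_prod integral_at_diff integral_at_mult integral_at_power) simp_all

text \<open>Shifting the starting point by one step trades the first factor 1 - Q for 1 - Q^(4m+1);
  this is where [n] comes from.\<close>

lemma qpoch_5_eq_qint:
  fixes Q :: "'b::field"
  assumes "Q \<noteq> 1"
  shows "qpoch (Q^5) (Q^4) m = qint Q (4*m+1) * qpoch Q (Q^4) m"
proof -
  have "(1 - Q) * qpoch (Q^5) (Q^4) m = qpoch Q (Q^4) m * (1 - Q ^ (4*m+1))"
  proof -
    have "Q * Q^4 = Q^5" by (simp add: eval_nat_numeral)
    moreover have "Q * (Q^4)^m = Q ^ (4*m+1)" by (simp flip: power_mult)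
    ultimately show ?thesis
      using trans[OF sym[OF qpoch_Suc_left] qpoch_Suc, of Q "Q^4" m] by (simp only:)
  qed
  then show ?thesis using assms by (simp add: qint_def field_simps)
qed

text \<open>Modulo 1 - QST it replaces (1 - S)(1 - T) / (1 - QT) by (1 - QS) / Q. It is applied with
  S = Q^s, T = Q^t/b and 1 + s + t = n.\<close>

lemma linear_factor_identity:
  fixes S T Q :: "'b::comm_ring_1"
  shows "(1 - S) * (1 - T) * Q - (1 - Q * S) * (1 - Q * T) = (1 - Q * S * T) * (- (1 - Q))"
  by (simp add: algebra_simps)

lemma qpoch_reverse: "qpoch x y m = (\<Prod>i<m. 1 - x * y ^ (m - Suc i))"
  unfolding qpoch_def by (rule prod.nat_diff_reindex[symmetric])

text \<open>In the asymmetric form the summand j = 0 cancels all of (Q^5/b;Q^4)_m, whereas each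
  summand with j > 0 leaves its last factor 1 - Q^n/b. Only j = 0 survives, and its product is
  evaluated factor by factor.\<close>

lemma base_sum_rcong_linear:
  fixes b Q :: rfun and m :: nat
  defines "n \<equiv> 4*m+1"
  assumes gen: "generic Q b" and uQ: "unit_at P Q" and ub: "unit_at P b"
    and u: "\<And>i. 0 < i \<Longrightarrow> unit_at P (1 - Q ^ i)" "\<And>i. 0 < i \<Longrightarrow> unit_at P (1 - b * Q ^ i)"
      "\<And>i. 0 < i \<Longrightarrow> i \<noteq> n \<Longrightarrow> unit_at P (1 - Q ^ i / b)"
    and van: "rcong (1 - Q ^ n / b) 0 P"
  shows "rcong (base_sum Q b m) (qint Q n * qpoch (Q^2) (Q^4) m / qpoch (Q^4) (Q^4) m / Q ^ m) P"
proof -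
  note g = genericD[OF gen]
  have e: "Q ^ s * (Q^4) ^ i = Q ^ (s + 4*i)" for s i by (simp add: power_add power_mult)
  have iQ: "integral_at P (Q ^ s)" for s using uQ by (simp add: unit_at_integral unit_at_power)
  have iQb: "integral_at P (Q ^ s / b)" for s using integral_at_divide[OF iQ ub] .
  have uc: "unit_at P (qpoch (Q ^ s) (Q^4) k)" if "0 < s" for s k
    using that by (intro unit_at_qpoch) (simp add: e u(1))
  have ubc: "unit_at P (qpoch (b * Q ^ s) (Q^4) k)" if "0 < s" for s k
    using that by (intro unit_at_qpoch) (simp add: e u(2) mult.assoc)
  have ucb: "unit_at P (qpoch (Q ^ s / b) (Q^4) k)" if "0 < s" "\<And>i. i < k \<Longrightarrow> s + 4*i \<noteq> n" for s k
    using that by (intro unit_at_qpoch) (simp add: e u(3))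
  have ic: "integral_at P (qpoch (Q ^ s / b) (Q^4) k)" for s k
    by (intro integral_at_qpoch iQ iQb)
  have iq1: "integral_at P (qpoch Q (Q^4) k)" and ib1: "integral_at P (qpoch (b*Q) (Q^4) k)" for k
    using uc[of 1 k] ubc[of 1 k] by (simp_all add: unit_at_integral)
  define pref where "pref = qpoch (Q^5) (Q^4) m * qpoch (Q^5/b) (Q^4) m / (qpoch (Q^4) (Q^4) m * qpoch (Q^4/b) (Q^4) m)"
  define r where "r j = qpoch (Q^3/b) (Q^4) (m - j) / qpoch (Q^5/b) (Q^4) (m - j)
        * (qpoch Q (Q^4) j * qpoch (b*Q) (Q^4) j / (qpoch (Q^4) (Q^4) j * qpoch (b*Q^4) (Q^4) j) * (Q^2) ^ j)" for j
  have tail: "rcong (pref * r j) 0 P" if j: "j \<in> {0<..m}" for j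
  proof -
    from j obtain l where l: "m = Suc l" by (cases m) auto
    have n5: "Q^5 * (Q^4)^l = Q ^ n" by (simp add: e n_def l)
    define Z where "Z = qpoch (Q^5) (Q^4) m * qpoch (Q^5/b) (Q^4) l / (qpoch (Q^4) (Q^4) m * qpoch (Q^4/b) (Q^4) m) * r j"
    have "pref * r j = (1 - Q ^ n / b) * Z"
      unfolding pref_def Z_def l qpoch_Suc[of "Q^5/b"] times_divide_eq_left n5 by simp
    moreover have "integral_at P Z"
    proof -
      \<comment> \<open>For j > 0 the exponents in (Q^5/b;Q^4)_(m-j) stay below n, and those in
        (Q^4/b;Q^4)_m are multiples of 4; so the modulus meets no denominator.\<close>
      have "5 + 4 * i \<noteq> n" if "i < m - j" for i using that j by (auto simp: n_def)
      moreover have "4 + 4 * i \<noteq> n" for i by (simp add: n_def) presburger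
      ultimately show ?thesis
        unfolding Z_def r_def
        by (intro integral_at_mult integral_at_divide unit_at_mult ic uc ubc ucb iq1 ib1
            integral_at_power[OF iQ] unit_at_integral[OF uc]) simp_all
    qed
    ultimately show ?thesis using rcong_0_integral_mult[OF van] by simp
  qed
  have head: "rcong (pref * r 0) (qint Q n * qpoch (Q^2) (Q^4) m / qpoch (Q^4) (Q^4) m / Q ^ m) P"
  proof -
    define K where "K = qint Q n / qpoch (Q^4) (Q^4) m"
    \<comment> \<open>Reversing (Q;Q^4)_m pairs the exponent 4(m-1-i) + 1 with 3 + 4i, and their sum
      is n - 1 for every i. The m factors 1/Q in \<open>Y\<close> make up Q^(-m).\<close>
    define X where "X i = (1 - Q * (Q^4) ^ (m - Suc i)) * (1 - Q^3/b * (Q^4)^i) / (1 - Q^4/b * (Q^4)^i)" for i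
    define Y where "Y i = (1 - Q^2 * (Q^4) ^ (m - Suc i)) / Q" for i
    have "qpoch (Q^5/b) (Q^4) m \<noteq> 0" by (intro qpoch_nonzero g(9)) simp
    then have "pref * r 0 = K * (qpoch Q (Q^4) m * qpoch (Q^3/b) (Q^4) m / qpoch (Q^4/b) (Q^4) m)"
      unfolding pref_def r_def K_def qpoch_5_eq_qint[OF g(3)] n_def by simp
    also have "qpoch Q (Q^4) m * qpoch (Q^3/b) (Q^4) m / qpoch (Q^4/b) (Q^4) m = (\<Prod>i<m. X i)"
      unfolding X_def prod_dividef prod.distrib qpoch_reverse[of Q] qpoch_def[of "_ / b"] ..
    finally have head: "pref * r 0 = K * (\<Prod>i<m. X i)" .
    have Y: "qint Q n * qpoch (Q^2) (Q^4) m / qpoch (Q^4) (Q^4) m / Q ^ m = K * (\<Prod>i<m. Y i)"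
      unfolding Y_def prod_dividef qpoch_reverse[of "Q^2"] K_def by simp
    have "integral_at P (1 - Q ^ n)"
      by (intro integral_at_diff iQ) simp
    then have "integral_at P K"
      unfolding K_def qint_def using u(1)[of 1] by (intro integral_at_divide uc) simp_all
    moreover have "rcong (\<Prod>i<m. X i) (\<Prod>i<m. Y i) P"
    proof (rule rcong_prod, intro conjI)
      fix i assume i: "i \<in> {..<m}"
      have uX: "unit_at P (1 - Q^4/b * (Q^4)^i)"
      proof -
        have "4 + 4*i \<noteq> n" unfolding n_def by presburger
        then show ?thesis using u(3)[of "4 + 4*i"] by (simp add: e)
      qed
      show "integral_at P (X i)"
        unfolding X_def by (intro integral_at_divide[OF _ uX] integral_at_mult integral_at_diff integral_at_1
              iQb unit_at_integral[OF uQ] integral_at_power[OF iQ])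
      show "integral_at P (Y i)"
        unfolding Y_def by (intro integral_at_divide integral_at_mult integral_at_diff uQ integral_at_1
              iQ integral_at_power[OF iQ])
      define s t where "s = 4 * (m - Suc i) + 1" and "t = 3 + 4 * i"
      have st: "Q ^ n = Q * Q ^ s * Q ^ t" proof -
        have "n = 1 + s + t" using i by (auto simp: s_def t_def n_def)
        then show ?thesis by (simp add: power_add)
      qed
      have tt: "Q ^ (4 + 4*i) = Q * Q ^ t"
        unfolding power_Suc[symmetric] by (rule arg_cong) (simp add: t_def)
      have ss: "Q * (Q^4) ^ (m - Suc i) = Q ^ s" "Q^2 * (Q^4) ^ (m - Suc i) = Q * Q ^ s"
        unfolding power_mult[symmetric] s_def
        by (simp_all add: power_add power2_eq_square)
      have X: "X i = (1 - Q ^ s) * (1 - Q ^ t / b) / (1 - Q * Q ^ t / b)"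
        unfolding X_def times_divide_eq_left e tt ss by (simp only: t_def)
      have Y: "Y i = (1 - Q * Q ^ s) / Q"
        unfolding Y_def ss ..
      have uX': "unit_at P (1 - Q * Q ^ t / b)"
        using uX unfolding times_divide_eq_left e tt .
      show "rcong (X i) (Y i) P"
      proof (rule rcong_of_diff[OF van])
        show "integral_at P (- ((1 - Q) / ((1 - Q * Q ^ t / b) * Q)))"
          by (intro integral_at_uminus integral_at_divide unit_at_mult uX' uQ integral_at_diff)
            (use iQ[of 1] in simp_all)
        have "1 - Q * Q ^ t / b \<noteq> 0" by (rule unit_at_nonzero[OF uX'])
        then have "X i - Y i = ((1 - Q ^ s) * (1 - Q ^ t / b) * Q - (1 - Q * Q ^ s) * (1 - Q * Q ^ t / b)) / ((1 - Q * Q ^ t / b) * Q)"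
          unfolding X Y using g(1) by (rule diff_frac_eq)
        also have "(1 - Q ^ s) * (1 - Q ^ t / b) * Q - (1 - Q * Q ^ s) * (1 - Q * Q ^ t / b) = (1 - Q ^ n / b) * (- (1 - Q))"
          using linear_factor_identity[of "Q^s" "Q^t/b" Q] by (simp only: st times_divide_eq_right)
        finally show "X i - Y i = (1 - Q ^ n / b) * (- ((1 - Q) / ((1 - Q * Q ^ t / b) * Q)))"
          by (simp only: times_divide_eq_right minus_divide_left)
      qed
    qed
    ultimately show ?thesis
      unfolding head Y mult.commute[of K] by (intro rcong_mult_right)
  qed
  have "base_sum Q b m = pref * (\<Sum>j\<le>m. r j)"
    unfolding base_sum_watson_asymmetric[OF gen] pref_def r_def ..
  also have "\<dots> = pref * r 0 + (\<Sum>j\<in>{0<..m}. pref * r j)"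
  proof -
    have "{..m} = insert 0 {0<..m}" by auto
    then show ?thesis by (simp add: distrib_left sum_distrib_left)
  qed
  finally have "base_sum Q b m = \<dots>" .
  then show ?thesis
    using rcong_add[OF head rcong_sum[of "{0<..m}" "\<lambda>j. pref * r j" "\<lambda>_. 0", OF tail]] by simp
qed

text \<open>Transfers a congruence for \<open>base_sum\<close> to the weighted sum by discarding the
  boundary term. That term contains both [n] and 1 - Q^n/b, so the single assumption
  \<open>van\<close> serves all three moduli.\<close>

lemma weighted_sum_rcong:
  fixes b q R :: rfun and m :: nat
  defines "Q \<equiv> q^2" and "n \<equiv> 4*m+1"
  assumes gen: "generic Q b" and q: "q \<noteq> 1" and uQ: "unit_at P Q" and ub: "unit_at P b"
    and u: "\<And>i. 0 < i \<Longrightarrow> unit_at P (1 - b * Q ^ i)"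
      "\<And>i. 0 < i \<Longrightarrow> i \<noteq> n \<Longrightarrow> unit_at P (1 - Q ^ i / b)"
    and uD: "unit_at P ((1 - q)^2 * (1 + q^2))"
    and int: "integral_at P (qpoch Q (Q^4) m / qpoch (Q^4) (Q^4) m)" "integral_at P (qint Q n)"
    and van: "rcong (qint Q n * (1 - Q ^ n / b)) 0 P"
    and base: "rcong (base_sum Q b m) R P"
  shows "rcong (weighted_sum q b m) (R * closing_factor q b) P"
proof -
  note g = genericD[OF gen]
  have e: "Q ^ s * (Q^4) ^ i = Q ^ (s + 4*i)" for s i by (simp add: power_add power_mult)
  have iQ: "integral_at P (Q ^ s)" for s using uQ by (simp add: unit_at_integral unit_at_power)
  have iQb: "integral_at P (Q ^ s / b)" for s using integral_at_divide[OF iQ ub] .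
  note iQ1 = unit_at_integral[OF uQ] and ib = unit_at_integral[OF ub]
  have iQb1: "integral_at P (Q / b)" using iQb[of 1] by simp
  have ud: "unit_at P (qpoch (b * Q ^ 4) (Q^4) m)" "unit_at P (qpoch (Q ^ 4 / b) (Q^4) m)"
  proof -
    have "4 + 4 * i \<noteq> n" for i unfolding n_def by presburger
    then show "unit_at P (qpoch (b * Q ^ 4) (Q^4) m)" "unit_at P (qpoch (Q ^ 4 / b) (Q^4) m)"
      by (intro unit_at_qpoch; simp add: e u mult.assoc)+
  qed
  \<comment> \<open>The boundary factor (1 - Q^n)^2 is [n]^2 (1 - Q)^2, and (1 - Q)^2 cancels
    against (1 - Q)(1 - Q^2). One factor [n] is used for \<open>van\<close>, the other remains in
    \<open>Z\<close>.\<close>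
  define Z where "Z = (qpoch Q (Q^4) m / qpoch (Q^4) (Q^4) m)^2 * qpoch (b*Q) (Q^4) m * qpoch (Q/b) (Q^4) m
     * (1 - b * Q ^ n) * qint Q n / (qpoch (b*Q^4) (Q^4) m * qpoch (Q^4/b) (Q^4) m * Q ^ (2*m) * ((1 - q)^2 * (1 + q^2)))"
  have "integral_at P Z"
    unfolding Z_def
    by (intro integral_at_divide integral_at_mult integral_at_power unit_at_mult ud uD int ib iQ1 iQb1
        unit_at_power[OF uQ] integral_at_qpoch integral_at_diff integral_at_1)
  then have "rcong (qint Q n * (1 - Q ^ n / b) * Z) 0 P"
    by (rule rcong_0_integral_mult[OF van])
  also have "qint Q n * (1 - Q ^ n / b) * Z = boundary Q b m / ((1 - Q) * (1 - q)^2 * (1 - Q^2))"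
  proof -
    have 1: "1 - Q ^ (4*m+1) = qint Q n * (1 - Q)" using g(3) by (simp add: qint_def n_def)
    have 2: "1 - Q^2 = (1 - Q) * (1 + Q)" by (simp add: power2_eq_square algebra_simps)
    have 3: "f * ((a * (1 - Q))^2 * x * y) / ((1 - Q) * c * ((1 - Q) * d)) = f * (a * (a * (x * y)) / (c * d))" for f a c d x y
      using g(3) by (simp add: power2_eq_square)
    show ?thesis
      unfolding boundary_def 1 2 3 Z_def unfolding n_def[symmetric]
      by (simp add: power_divide mult_ac Q_def)
  qed
  finally have bd: "rcong (boundary Q b m / ((1 - Q) * (1 - q)^2 * (1 - Q^2))) 0 P" .
  have "integral_at P (closing_factor q b)"
    unfolding closing_factor_def Q_def[symmetric]
    by (intro integral_at_diff integral_at_divide integral_at_mult integral_at_1 ib iQ1 iQb1 uD[folded Q_def])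
  with base have "rcong (base_sum Q b m * closing_factor q b) (R * closing_factor q b) P"
    by (rule rcong_mult_right)
  from rcong_add[OF this bd] show ?thesis
    using weighted_sum_eq_base_sum[of q b m] gen q by (simp add: Q_def mult.commute)
qed

section \<open>Quotients of q-factorials and the modulus [n]\<close>

lemma integral_at_gaussian_binomial:
  fixes x :: rfun
  assumes x: "integral_at P x" and ne: "\<And>i. 0 < i \<Longrightarrow> x ^ i \<noteq> 1"
  shows "integral_at P (qpoch x x (r + s) / (qpoch x x r * qpoch x x s))"
proof (induction "r + s" arbitrary: r s)
  case 0
  then show ?case by simp
next
  case (Suc l)
  have nz: "qpoch x x k \<noteq> 0" for k
    by (rule qpoch_nonzero) (metis ne power_Suc zero_less_Suc)
  show ?case
  proof (cases "r = 0 \<or> s = 0")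
    case True
    then show ?thesis using nz by auto
  next
    case False
    then obtain r' s' where rs: "r = Suc r'" "s = Suc s'" by (cases r; cases s) auto
    have l: "l = r' + s" "l = r + s'" using Suc(2) rs by auto
    \<comment> \<open>The q-Pascal rule: the recurrence it gives is free of division, so integrality
      does not depend on which factors \<open>P\<close> shares with the q-factorials.\<close>
    have "1 - x * x ^ l = (1 - x * x ^ r') + x ^ r * (1 - x * x ^ s')"
      using l rs by (simp add: algebra_simps power_add)
    then have "qpoch x x (Suc l) = qpoch x x l * ((1 - x * x ^ r') + x ^ r * (1 - x * x ^ s'))"
      by (simp only: qpoch_Suc)
    then have "qpoch x x (Suc l) / (qpoch x x r * qpoch x x s)
        = (qpoch x x l * (1 - x * x ^ r') + x ^ r * qpoch x x l * (1 - x * x ^ s')) / (qpoch x x r * qpoch x x s)"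
      by (simp only: distrib_left mult_ac)
    also have "\<dots> = qpoch x x l / (qpoch x x r' * qpoch x x s) + x ^ r * (qpoch x x l / (qpoch x x r * qpoch x x s'))"
    proof -
      have "1 - x * x ^ r' \<noteq> 0" "1 - x * x ^ s' \<noteq> 0" using ne[of "Suc r'"] ne[of "Suc s'"] by auto
      then show ?thesis unfolding add_divide_distrib rs qpoch_Suc by (simp add: mult_ac)
    qed
    also have "integral_at P \<dots>"
      using Suc(1)[OF l(1)] Suc(1)[OF l(2)] unfolding l[symmetric]
      by (intro integral_at_add integral_at_mult integral_at_power x)
    finally show ?thesis unfolding Suc(2)[symmetric] .
  qed
qed

text \<open>Here \<open>n\<close> is the exponent of the top factor. Exposing n, n - 4, n - 8, ...
  prepares the pairing of n - 4i with 4i, where gcd(4i, n) divides n - 4i.\<close>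

lemma qpoch_drop_top:
  fixes Q :: "'b::comm_ring_1"
  assumes "j \<le> m" "n + 4 = 4 * m + s"
  shows "qpoch (Q ^ s) (Q^4) m = qpoch (Q ^ s) (Q^4) (m - j) * (\<Prod>i<j. 1 - Q ^ (n - 4 * i))"
  using assms(1)
proof (induction j)
  case (Suc j)
  then obtain l where l: "m = Suc (j + l)" using less_iff_Suc_add[of j m] by auto
  have "Q ^ s * (Q^4) ^ l = Q ^ (n - 4 * j)"
    using assms(2) l by (auto simp flip: power_mult power_add intro!: arg_cong[of _ _ "(^) Q"])
  then show ?case using Suc by (simp add: l qpoch_Suc mult_ac)
qed simp

text \<open>Both sides are [n] times something integral, hence zero modulo \<open>P\<close>. The
  assumption \<open>ratio\<close> replaces invertibility of the factors 1 - Q^j, which can fail for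
  composite n.\<close>

lemma base_sum_rcong_qint:
  fixes b Q :: rfun and m :: nat
  defines "n \<equiv> 4*m+1"
  assumes gen: "generic Q b" and uQ: "unit_at P Q" and ub: "unit_at P b"
    and u: "\<And>i. 0 < i \<Longrightarrow> unit_at P (1 - b * Q ^ i)" "\<And>i. 0 < i \<Longrightarrow> unit_at P (1 - Q ^ i / b)"
    and ratio: "\<And>i j. 0 < j \<Longrightarrow> gcd j n dvd i \<Longrightarrow> integral_at P ((1 - Q ^ i) / (1 - Q ^ j))"
    and van: "rcong (qint Q n) 0 P"
  shows "integral_at P (qpoch Q (Q^4) m / qpoch (Q^4) (Q^4) m)"
    and "rcong (base_sum Q b m) (qint Q n * qpoch (Q^2) (Q^4) m / qpoch (Q^4) (Q^4) m / Q ^ m) P"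
proof -
  note g = genericD[OF gen]
  have e: "Q ^ s * (Q^4) ^ i = Q ^ (s + 4*i)" for s i by (simp add: power_add power_mult)
  have iQ: "integral_at P (Q ^ s)" for s using uQ by (simp add: unit_at_integral unit_at_power)
  note iQ1 = unit_at_integral[OF uQ] and ib = unit_at_integral[OF ub]
  have iQb1: "integral_at P (Q / b)" using integral_at_divide[OF iQ1 ub] .
  have p: "qpoch (Q^4) (Q^4) j = (\<Prod>i<j. 1 - Q ^ (4 * Suc i))" for j
    by (simp add: qpoch_def e)
  have dvd: "gcd (4 * k) n dvd n - 4 * k" "gcd (4 * k) n dvd n" for k
    by (intro dvd_diff_nat) auto
  have E1: "integral_at P (qpoch Q (Q^4) m / qpoch (Q^4) (Q^4) j)" if "j \<le> m" for j
  proof -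
    have "n - 4 * Suc i = n - 4 - 4 * i" for i by simp
    \<comment> \<open>The top exponent is now n - 4; m = 0 is separate because there n - 4 truncates
      to 0.\<close>
    then have "qpoch Q (Q^4) m = qpoch Q (Q^4) (m - j) * (\<Prod>i<j. 1 - Q ^ (n - 4 * Suc i))"
      using qpoch_drop_top[OF that, of "n - 4" 1 Q] that
      by (cases "m = 0") (simp_all add: n_def)
    then have "qpoch Q (Q^4) m / qpoch (Q^4) (Q^4) j
        = qpoch Q (Q^4) (m - j) * (\<Prod>i<j. (1 - Q ^ (n - 4 * Suc i)) / (1 - Q ^ (4 * Suc i)))"
      unfolding p prod_dividef by simp
    moreover have "integral_at P \<dots>"
      by (intro integral_at_mult integral_at_qpoch integral_at_prod ratio dvd iQ iQ1) simp
    ultimately show ?thesis by simp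
  qed
  from E1[of m] show "integral_at P (qpoch Q (Q^4) m / qpoch (Q^4) (Q^4) m)" by simp
  \<comment> \<open>The numerator exponents are n, n - 4, ..., n - 4(j-1). Each n - 4i with i > 0
    goes with 4i, and the remaining n goes with 4j, since gcd(4j, n) divides n.\<close>
  have E2: "integral_at P (qpoch (Q^5) (Q^4) m / qpoch (Q^5) (Q^4) (m - j) / qpoch (Q^4) (Q^4) j)" if "j \<le> m" for j
  proof (cases j)
    case 0
    have "qpoch (Q^5) (Q^4) m \<noteq> 0" by (intro qpoch_nonzero g(7)) simp
    then show ?thesis using 0 by simp
  next
    case (Suc k)
    have "qpoch (Q^5) (Q^4) (m - j) \<noteq> 0" by (intro qpoch_nonzero g(7)) simp
    then have "qpoch (Q^5) (Q^4) m / qpoch (Q^5) (Q^4) (m - j) = (\<Prod>i<j. 1 - Q ^ (n - 4 * i))"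
      using qpoch_drop_top[OF that, of n 5 Q] by (simp add: n_def)
    also have "\<dots> = (1 - Q ^ n) * (\<Prod>i<k. 1 - Q ^ (n - 4 * Suc i))"
      unfolding Suc prod.lessThan_Suc_shift by simp
    finally have "qpoch (Q^5) (Q^4) m / qpoch (Q^5) (Q^4) (m - j) / qpoch (Q^4) (Q^4) j
      = (1 - Q ^ n) / (1 - Q ^ (4 * Suc k)) * (\<Prod>i<k. (1 - Q ^ (n - 4 * Suc i)) / (1 - Q ^ (4 * Suc i)))"
      unfolding p Suc prod.lessThan_Suc prod_dividef by simp
    also have "integral_at P \<dots>"
      by (intro integral_at_mult integral_at_prod ratio dvd) simp_all
    finally show ?thesis .
  qed
  define r where "r j = qpoch Q (Q^4) m / qpoch (Q^4) (Q^4) j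
    * (qpoch (Q^5) (Q^4) m / qpoch (Q^5) (Q^4) (m - j) / qpoch (Q^4) (Q^4) j)
    * (qpoch (Q^3) (Q^4) (m - j) * qpoch (b*Q) (Q^4) j * qpoch (Q/b) (Q^4) j * (Q^2) ^ j)
    / (qpoch (Q^4/b) (Q^4) m * qpoch (b*Q^4) (Q^4) m)" for j
  have ud: "unit_at P (qpoch (b * Q ^ 4) (Q^4) m)" "unit_at P (qpoch (Q ^ 4 / b) (Q^4) m)"
    by (intro unit_at_qpoch; simp add: e u mult.assoc)+
  have "base_sum Q b m = qint Q n * (\<Sum>j\<le>m. r j)"
    unfolding base_sum_watson_symmetric[OF gen] r_def sum_distrib_left power2_eq_square[of "qpoch _ _ m"]
    by (intro sum.cong) (simp_all add: qpoch_5_eq_qint[OF g(3), of m] n_def power2_eq_square mult_ac)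
  moreover have "integral_at P (\<Sum>j\<le>m. r j)"
    unfolding r_def
    by (intro integral_at_sum integral_at_divide[OF _ unit_at_mult] integral_at_mult E1 E2 ud integral_at_qpoch
        iQ iQ1 iQb1 ib integral_at_power[OF iQ]) simp_all
  ultimately have 1: "rcong (base_sum Q b m) 0 P"
    using rcong_0_integral_mult[OF van] by simp
  define x where "x = Q^2"
  have x: "x ^ i = Q ^ (2 * i)" for i
    by (simp only: x_def power_mult)
  have xx: "x * x ^ i = Q ^ (2 * Suc i)" for i
    using x[of "Suc i"] by (simp only: power_Suc)
  \<comment> \<open>As n is odd, gcd(4i, n) already divides i, so 1 - Q^(2i) may be divided by 1 -
    Q^(4i).\<close>
  have half: "integral_at P (qpoch x x m / qpoch (Q^4) (Q^4) m)"
  proof -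
    have "coprime (gcd (4 * k) n) (2 ^ 2)" for k
    proof (rule coprime_divisors[OF gcd_dvd2 dvd_refl])
      have "odd n" by (simp add: n_def)
      then show "coprime n (2 ^ 2)" by (simp only: coprime_power_right_iff coprime_right_2_iff_odd simp_thms)
    qed
    then have "gcd (4 * Suc i) n dvd Suc i" for i
      using coprime_dvd_mult_right_iff[of "gcd (4 * Suc i) n" "2^2" "Suc i"] gcd_dvd1[of "4 * Suc i" n]
      by (simp only: power2_eq_square) simp
    then have "gcd (4 * Suc i) n dvd 2 * Suc i" for i
      by (rule dvd_mult)
    then show ?thesis
      unfolding p qpoch_def[of x] xx prod_dividef[symmetric] by (intro integral_at_prod ratio) simp_all
  qed
  \<comment> \<open>Splitting (x;x)_(2m) into odd and even exponents writes the closed form as a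
    central Gaussian binomial times the square of the quotient in \<open>half\<close>.\<close>
  have "qpoch x x (m + m) = qpoch (Q^2) (Q^4) m * qpoch (Q^4) (Q^4) m"
  proof (induction m)
    case (Suc m)
    have q4: "Q^4 = x * x" by (simp add: x_def flip: power_add)
    have q4m: "(Q^4) ^ m = x ^ (m + m)" unfolding q4 by (simp add: power_add power_mult_distrib)
    have "x * x ^ (m + m) = Q^2 * (Q^4)^m" unfolding q4m x_def[symmetric] ..
    moreover have "x * x ^ Suc (m + m) = Q^4 * (Q^4)^m" unfolding q4m unfolding q4 by simp
    ultimately show ?case by (simp add: qpoch_Suc Suc)
  qed simp
  moreover have "qpoch (Q^4) (Q^4) m \<noteq> 0" "qpoch x x m \<noteq> 0"
    by (intro qpoch_nonzero g(7), simp) (rule qpoch_nonzero, unfold xx, rule g(4), simp)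
  ultimately have eq: "qpoch (Q^2) (Q^4) m / qpoch (Q^4) (Q^4) m
      = qpoch x x (m + m) / (qpoch x x m * qpoch x x m) * (qpoch x x m / qpoch (Q^4) (Q^4) m)^2"
    by (simp add: power2_eq_square)
  have gau: "integral_at P (qpoch x x (m + m) / (qpoch x x m * qpoch x x m))"
  proof (rule integral_at_gaussian_binomial)
    show "integral_at P x" using iQ[of 2] by (simp add: x_def)
    show "x ^ i \<noteq> 1" if "0 < i" for i unfolding x using g(4)[of "2 * i"] that by simp
  qed
  have "integral_at P (qpoch (Q^2) (Q^4) m / qpoch (Q^4) (Q^4) m / Q ^ m)"
    unfolding eq
    by (rule integral_at_divide[OF integral_at_mult[OF gau integral_at_power[OF half]] unit_at_power[OF uQ]])
  from rcong_0_integral_mult[OF van this]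
  have "rcong (qint Q n * qpoch (Q^2) (Q^4) m / qpoch (Q^4) (Q^4) m / Q ^ m) 0 P"
    by (simp only: times_divide_eq_right)
  from rcong_trans[OF 1 rcong_sym[OF this]]
  show "rcong (base_sum Q b m) (qint Q n * qpoch (Q^2) (Q^4) m / qpoch (Q^4) (Q^4) m / Q ^ m) P" .
qed

section \<open>Coprimality of the moduli\<close>

lemma qR_eq: "qR = to_fract qv" and aR_eq: "aR = to_fract av"
  by (simp_all add: qR_def aR_def to_fract_def)

lemma to_fract_power: "to_fract (x ^ k) = to_fract x ^ k"
  by (induction k) simp_all

lemma qR_power: "(qR^2) ^ i = to_fract (qv ^ (2*i))"
  by (simp add: qR_eq to_fract_power power_mult)

lemma qv_power: "qv ^ i = [:[:0, 1:] ^ i:]"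
  by (simp add: qv_def poly_const_pow)

lemma X_power_eq_iff: "([:0, 1:] :: rat poly) ^ i = [:0, 1:] ^ j \<longleftrightarrow> i = j"
  by (metis degree_linear_power)

lemma qv_power_diff: "i \<noteq> j \<Longrightarrow> \<exists>u. u \<noteq> 0 \<and> qv ^ i - qv ^ j = [:u:]"
  by (rule exI[of _ "[:0, 1:] ^ i - [:0, 1:] ^ j"]) (simp add: qv_power X_power_eq_iff)

lemma coeff_linear: "coeff (av - qv ^ i) 1 = 1" "coeff (1 - av * qv ^ i) 0 = 1" "coeff av 1 = 1"
  by (simp_all add: av_def qv_power)

lemma coprime_linear_linear: "i \<noteq> j \<Longrightarrow> coprime (av - qv ^ i) (av - qv ^ j)"
proof -
  assume "i \<noteq> j"
  then obtain u where u: "u \<noteq> 0" "qv ^ j - qv ^ i = [:u:]" using qv_power_diff[of j i] by auto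
  have "1 * (av - qv ^ i) + (-1) * (av - qv ^ j) = [:u:]" using u(2) by (simp add: algebra_simps)
  from coprime_of_const_combination[OF this u(1), of 1] show ?thesis by (simp only: coeff_linear) simp
qed

lemma coprime_reciprocal_reciprocal: "i \<noteq> j \<Longrightarrow> coprime (1 - av * qv ^ i) (1 - av * qv ^ j)"
proof -
  assume "i \<noteq> j"
  then obtain u where u: "u \<noteq> 0" "qv ^ j - qv ^ i = [:u:]" using qv_power_diff[of j i] by auto
  have "qv ^ j * (1 - av * qv ^ i) + (- (qv ^ i)) * (1 - av * qv ^ j) = [:u:]"
    using u(2) by (simp add: algebra_simps)
  from coprime_of_const_combination[OF this u(1), of 0] show ?thesis by (simp only: coeff_linear) simp
qed

lemma coprime_linear_reciprocal: "0 < i + j \<Longrightarrow> coprime (av - qv ^ i) (1 - av * qv ^ j)"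
proof -
  assume "0 < i + j"
  then obtain u where u: "u \<noteq> 0" "qv ^ 0 - qv ^ (i + j) = [:u:]" using qv_power_diff[of 0 "i + j"] by auto
  have "qv ^ j * (av - qv ^ i) + 1 * (1 - av * qv ^ j) = [:u:]"
    using u(2) by (simp add: algebra_simps power_add)
  from coprime_of_const_combination[OF this u(1), of 1] show ?thesis by (simp only: coeff_linear) simp
qed

lemma coprime_av_linear: "coprime av (av - qv ^ i)"
proof -
  have "1 * av + (-1) * (av - qv ^ i) = [:[:0, 1:] ^ i:]" by (simp add: qv_power)
  from coprime_of_const_combination[OF this, of 1] show ?thesis by (simp only: coeff_linear) simp
qed

lemma coprime_av_reciprocal: "coprime av (1 - av * qv ^ i)"
proof (rule coprimeI)
  fix c assume "c dvd av" "c dvd 1 - av * qv ^ i"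
  then have "c dvd (1 - av * qv ^ i) + av * qv ^ i" by (meson dvd_add dvd_mult2)
  then show "is_unit c" by simp
qed

lemma generic_aR: "generic (qR^2) aR" and generic_aR_inverse: "generic (qR^2) (1 / aR)"
proof -
  have a0: "av \<noteq> 0" and q0: "qv \<noteq> 0" by (simp_all add: av_def qv_def)
  have q: "(qR^2) ^ i \<noteq> 1" if i: "0 < i" for i
  proof -
    obtain u where "u \<noteq> 0" "qv ^ (2*i) - qv ^ 0 = [:u:]" using qv_power_diff[of "2*i" 0] i by auto
    then have "qv ^ (2*i) \<noteq> 1" by auto
    then show ?thesis by (simp add: qR_power flip: to_fract_1)
  qed
  have "1 - av * qv ^ (2*i) \<noteq> 0" "av - qv ^ (2*i) \<noteq> 0" for i
    using coeff_linear(1,2)[of "2*i"] by (metis coeff_0 zero_neq_one)+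
  then have aq: "aR * (qR^2) ^ i \<noteq> 1" "aR \<noteq> (qR^2) ^ i" for i
    by (simp_all add: qR_power aR_eq flip: to_fract_1 to_fract_mult)
  have n0: "qR^2 \<noteq> 0" "aR \<noteq> 0" using a0 q0 by (simp_all add: qR_eq aR_eq)
  show "generic (qR^2) aR" "generic (qR^2) (1 / aR)"
    unfolding generic_def using n0 q aq by (auto simp: mult.commute)
qed

section \<open>Units at the moduli\<close>

lemma unit_at_const:
  assumes "u \<noteq> 0" "is_unit (coeff P i)"
  shows "unit_at P (to_fract [:u:])"
  using assms by (intro unit_at_to_fract coprime_const_poly) auto

lemma unit_at_one_minus_qR_power:
  assumes "0 < i" "is_unit (coeff P j)"
  shows "unit_at P (1 - (qR^2) ^ i)"
proof -
  obtain u where u: "u \<noteq> 0" "qv ^ 0 - qv ^ (2*i) = [:u:]" using qv_power_diff[of 0 "2*i"] assms(1) by auto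
  then have "1 - (qR^2) ^ i = to_fract [:u:]" by (simp add: qR_power flip: u(2))
  then show ?thesis using unit_at_const[OF u(1) assms(2)] by simp
qed

lemma unit_at_qR:
  assumes "is_unit (coeff P j)"
  shows "unit_at P (qR^2)" "unit_at P ((1 - qR)^2 * (1 + qR^2))"
proof -
  have "qR^2 = to_fract [:[:0, 1:]^2:]" by (simp add: qR_eq qv_power flip: to_fract_power)
  then show "unit_at P (qR^2)" by (simp add: unit_at_const[OF _ assms])
  have "(1 - qR)^2 * (1 + qR^2) = to_fract ((1 - qv)^2 * (1 + qv^2))"
    by (simp add: qR_eq to_fract_power)
  also have "(1 - qv)^2 * (1 + qv^2) = [:[:1,-1:]^2 * [:1,0,1:]:]"
    by (simp add: qv_def power2_eq_square one_pCons)
  finally have *: "(1 - qR)^2 * (1 + qR^2) = to_fract [:[:1,-1:]^2 * [:1,0,1:]:]" .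
  show "unit_at P ((1 - qR)^2 * (1 + qR^2))"
    unfolding * by (rule unit_at_const[OF _ assms]) (simp only: mult_eq_0_iff power_eq_0_iff, simp)
qed

lemma unit_at_linear_factors:
  shows "coprime (1 - av * qv ^ (2*i)) P \<Longrightarrow> unit_at P (1 - aR * (qR^2) ^ i)"
    and "coprime (av - qv ^ (2*i)) P \<Longrightarrow> coprime av P \<Longrightarrow> unit_at P (1 - (qR^2) ^ i / aR)"
proof -
  have nz: "1 - av * qv ^ (2*i) \<noteq> 0" "av - qv ^ (2*i) \<noteq> 0" "av \<noteq> 0"
    using coeff_linear(1,2)[of "2*i"] coeff_linear(3) by (metis coeff_0 zero_neq_one)+
  have 1: "1 - aR * (qR^2) ^ i = to_fract (1 - av * qv ^ (2*i))" by (simp add: qR_power aR_eq)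
  show "coprime (1 - av * qv ^ (2*i)) P \<Longrightarrow> unit_at P (1 - aR * (qR^2) ^ i)"
    unfolding 1 using nz by (intro unit_at_to_fract)
  have 2: "1 - (qR^2) ^ i / aR = to_fract (av - qv ^ (2*i)) / to_fract av"
    using nz by (simp add: qR_power aR_eq diff_divide_distrib)
  show "coprime (av - qv ^ (2*i)) P \<Longrightarrow> coprime av P \<Longrightarrow> unit_at P (1 - (qR^2) ^ i / aR)"
    unfolding 2 using nz by (intro unit_at_divide unit_at_to_fract)
qed

definition closed_form :: "'b::field \<Rightarrow> nat \<Rightarrow> 'b" where
  "closed_form Q m = qint Q (4*m+1) * qpoch (Q^2) (Q^4) m / qpoch (Q^4) (Q^4) m / Q ^ m"

text \<open>A modulus having a coefficient that is a nonzero rational is prime to every nonzero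
  polynomial in q, so all denominators in q alone are units here.\<close>

lemma weighted_sum_rcong_linear:
  fixes b :: rfun and m :: nat
  defines "Q \<equiv> qR^2" and "n \<equiv> 4*m+1"
  assumes gen: "generic Q b" and c: "is_unit (coeff P j)" and ub: "unit_at P b"
    and u: "\<And>i. 0 < i \<Longrightarrow> unit_at P (1 - b * Q ^ i)" "\<And>i. 0 < i \<Longrightarrow> i \<noteq> n \<Longrightarrow> unit_at P (1 - Q ^ i / b)"
    and van: "rcong (1 - Q ^ n / b) 0 P"
  shows "rcong (weighted_sum qR b m) (closed_form Q m * closing_factor qR b) P"
proof -
  have q1: "qR \<noteq> 1" using genericD(3)[OF gen] by (auto simp: Q_def)
  note uQ = unit_at_one_minus_qR_power[OF _ c, folded Q_def]
  have e: "Q ^ s * (Q^4) ^ i = Q ^ (s + 4*i)" for s i by (simp add: power_add power_mult)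
  have iQ: "integral_at P (Q ^ s)" for s
    unfolding Q_def by (intro integral_at_power unit_at_integral unit_at_qR[OF c])
  have base: "rcong (base_sum Q b m) (closed_form Q m) P"
    unfolding closed_form_def using gen unit_at_qR(1)[OF c] ub uQ u van unfolding Q_def n_def
    by (intro base_sum_rcong_linear) auto
  have iint: "integral_at P (qint Q n)"
    unfolding qint_def using uQ[of 1]
    by (intro integral_at_divide integral_at_diff iQ integral_at_1) simp
  have "integral_at P (qpoch Q (Q^4) m / qpoch (Q^4) (Q^4) m)"
    using iQ[of 1]
    by (intro integral_at_divide integral_at_qpoch iQ unit_at_qpoch) (simp_all add: e uQ)
  moreover have "rcong (qint Q n * (1 - Q ^ n / b)) 0 P"
    using rcong_0_integral_mult[OF van iint] by (simp add: mult.commute)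
  ultimately show ?thesis
    using weighted_sum_rcong[of qR b P m "closed_form Q m"] gen q1 unit_at_qR[OF c] ub u base iint
    by (simp add: Q_def n_def)
qed

lemma weighted_sum_rcong_linear_moduli:
  fixes m :: nat
  defines "n \<equiv> 4*m+1"
  shows "rcong (weighted_sum qR aR m) (closed_form (qR^2) m * closing_factor qR aR) (av - qv ^ (2*n))"
    and "rcong (weighted_sum qR aR m) (closed_form (qR^2) m * closing_factor qR aR) (1 - av * qv ^ (2*n))"
proof -
  have av0: "av \<noteq> 0" by (simp add: av_def)
  have ua: "unit_at P aR \<and> integral_at P (1 / aR)" if "coprime av P" for P
    unfolding aR_eq using unit_at_to_fract[OF av0 that] by (simp add: unit_at_def)
  show "rcong (weighted_sum qR aR m) (closed_form (qR^2) m * closing_factor qR aR) (av - qv ^ (2*n))"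
  proof (rule weighted_sum_rcong_linear[OF generic_aR, of _ 1])
    show "unit_at (av - qv ^ (2*n)) aR" using ua[OF coprime_av_linear] by simp
    have "1 - (qR^2) ^ n / aR = to_fract (av - qv ^ (2*n)) * (1 / aR)"
      using av0 by (simp add: qR_power aR_eq diff_divide_distrib)
    then show "rcong (1 - (qR^2) ^ (4*m+1) / aR) 0 (av - qv ^ (2*n))"
      using ua[OF coprime_av_linear] unfolding n_def by (intro rcongI[of _ "1 / aR"]) (simp_all only: diff_zero)
    show "unit_at (av - qv ^ (2*n)) (1 - aR * (qR^2) ^ i)" if "0 < i" for i
      using coprime_linear_reciprocal[of "2*n" "2*i"] that by (intro unit_at_linear_factors) (simp add: coprime_commute)
    show "unit_at (av - qv ^ (2*n)) (1 - (qR^2) ^ i / aR)" if "i \<noteq> 4*m+1" for i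
      using that by (intro unit_at_linear_factors coprime_linear_linear coprime_av_linear) (simp add: n_def)
  qed (simp only: coeff_linear, simp)
  \<comment> \<open>With b = 1/a the vanishing factor 1 - Q^n/b is 1 - a Q^n.\<close>
  have "rcong (weighted_sum qR (1 / aR) m) (closed_form (qR^2) m * closing_factor qR (1 / aR)) (1 - av * qv ^ (2*n))"
  proof (rule weighted_sum_rcong_linear[OF generic_aR_inverse, of _ 0])
    show "unit_at (1 - av * qv ^ (2*n)) (1 / aR)"
      using ua[OF coprime_av_reciprocal] by (auto simp: unit_at_def)
    have "1 - (qR^2) ^ n / (1 / aR) = to_fract (1 - av * qv ^ (2*n)) * 1"
      by (simp add: qR_power aR_eq mult.commute)
    then show "rcong (1 - (qR^2) ^ (4*m+1) / (1 / aR)) 0 (1 - av * qv ^ (2*n))"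
      unfolding n_def by (intro rcongI[of _ 1]) (simp_all only: diff_zero integral_at_1)
    show "unit_at (1 - av * qv ^ (2*n)) (1 - 1 / aR * (qR^2) ^ i)" if "0 < i" for i
      using unit_at_linear_factors(2)[OF coprime_linear_reciprocal[of "2*i" "2*n"] coprime_av_reciprocal] that by simp
    show "unit_at (1 - av * qv ^ (2*n)) (1 - (qR^2) ^ i / (1 / aR))" if "i \<noteq> 4*m+1" for i
      using unit_at_linear_factors(1)[OF coprime_reciprocal_reciprocal[of "2*i" "2*n"]] that by (simp add: n_def mult.commute)
  qed (simp only: coeff_linear, simp)
  then show "rcong (weighted_sum qR aR m) (closed_form (qR^2) m * closing_factor qR aR) (1 - av * qv ^ (2*n))"
    by (simp only: weighted_sum_inverse closing_factor_inverse)
qed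

section \<open>Geometric sums and the divisors of [n]\<close>

lemma geometric_add:
  fixes R :: "'b::comm_ring_1"
  shows "(\<Sum>i<u + v. R ^ i) = (\<Sum>i<u. R ^ i) + R ^ u * (\<Sum>i<v. R ^ i)"
  by (induction v) (simp_all add: algebra_simps power_add)

lemma coprime_power_geometric:
  fixes R :: bpoly
  assumes "0 < v"
  shows "coprime (R ^ u) (\<Sum>i<v. R ^ i)"
proof (rule coprime_power_left_iff[THEN iffD2], rule disjI1, rule coprimeI)
  fix c assume c: "c dvd R" "c dvd (\<Sum>i<v. R ^ i)"
  obtain w where "v = 1 + w" using assms by (cases v) auto
  then have "(\<Sum>i<v. R ^ i) = 1 + R * (\<Sum>i<w. R ^ i)"
    using geometric_add[of R 1 w] by simp
  with c show "is_unit c" by (metis dvd_add_left_iff dvd_mult2)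
qed

text \<open>The Euclidean algorithm on the exponents: modulo the sum of length u, the sum of length
  u + w is R^u times the sum of length w, and R^u is prime to the modulus.\<close>

lemma coprime_geometric:
  fixes R :: bpoly
  assumes "coprime u v"
  shows "coprime (\<Sum>i<u. R ^ i) (\<Sum>i<v. R ^ i)"
  using assms
proof (induction "u + v" arbitrary: u v rule: less_induct)
  case less
  have sub: "coprime (\<Sum>i<u. R ^ i) (\<Sum>i<u + w. R ^ i)"
    if "coprime u w" "0 < u" "coprime (\<Sum>i<u. R ^ i) (\<Sum>i<w. R ^ i)" for u w
  proof -
    have "coprime (\<Sum>i<u. R ^ i) (R ^ u * (\<Sum>i<w. R ^ i))"
      using that coprime_power_geometric[of u R u] by (simp add: coprime_commute)
    then show ?thesis
      unfolding geometric_add coprime_iff_gcd_eq_1 by (metis gcd_add2)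
  qed
  consider "u = 0" | "v = 0" | "0 < u" "u \<le> v" | "0 < v" "v \<le> u" by linarith
  then show ?case
  proof cases
    case 1
    then show ?thesis using less(2) by simp
  next
    case 2
    then show ?thesis using less(2) by simp
  next
    case 3
    then obtain w where w: "v = u + w" using le_Suc_ex by blast
    with less(2) have "coprime u w" by (simp add: coprime_iff_gcd_eq_1)
    with less(1)[of u w] 3 w show ?thesis using sub[of u w] by simp
  next
    case 4
    then obtain w where w: "u = v + w" using le_Suc_ex by blast
    with less(2) have "coprime v w" by (simp add: coprime_iff_gcd_eq_1 gcd.commute)
    with less(1)[of v w] 4 w show ?thesis using sub[of v w] by (simp add: coprime_commute)
  qed
qed

text \<open>Modulo 1 - R every power of R is 1, so the sum becomes the nonzero rational v.\<close>

lemma coprime_geometric_one_minus: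
  fixes R :: bpoly
  assumes "0 < v" "c dvd 1 - R"
  shows "coprime (\<Sum>i<v. R ^ i) c"
proof (rule coprimeI)
  fix d assume d: "d dvd (\<Sum>i<v. R ^ i)" "d dvd c"
  have "1 - R dvd of_nat v - (\<Sum>i<v. R ^ i)"
  proof -
    have "1 - R dvd 1 - R ^ i" for i
      by (metis one_diff_power_eq dvd_triv_left)
    then have "1 - R dvd (\<Sum>i<v. 1 - R ^ i)" by (intro dvd_sum)
    then show ?thesis by (simp add: sum_subtractf)
  qed
  then have "d dvd of_nat v - (\<Sum>i<v. R ^ i)" using d(2) assms(2) by (meson dvd_trans)
  then have "d dvd of_nat v" using d(1) by (metis diff_add_cancel dvd_add)
  also have "of_nat v = [:[:of_nat v:]:]" by (simp add: of_nat_poly)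
  finally show "is_unit d"
    using assms(1) by (elim dvd_trans) (simp add: is_unit_const_poly_iff dvd_field_iff)
qed

text \<open>Put g = gcd(j, n) and R = Q^g. The quotient is [i/g]_R / [j/g]_R, while [n]_Q = [n/g]_R
  [g]_Q. The denominator is prime to [n/g]_R because j/g and n/g are coprime, and to [g]_Q because
  that divides 1 - R.\<close>

lemma integral_at_qint_ratio:
  assumes "0 < j" "0 < n" "gcd j n dvd i"
  shows "integral_at (\<Sum>i<n. qv ^ (2*i)) ((1 - (qR^2) ^ i) / (1 - (qR^2) ^ j))"
proof -
  define g where "g = gcd j n"
  obtain i' where i': "i = g * i'" using assms(3) unfolding g_def by blast
  obtain j' n' where jn: "j = g * j'" "n = g * n'" "coprime j' n'"
    using assms(1) gcd_coprime_exists[of j n] unfolding g_def by (auto simp: mult.commute)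
  have g0: "0 < g" "0 < j'" using assms(1) jn(1) by (auto intro!: Nat.gr0I)
  define R :: bpoly where "R = qv ^ (2 * g)"
  have R: "qv ^ (2 * (g * k)) = R ^ k" for k by (simp add: R_def flip: power_mult mult.assoc)
  have geo: "1 - y ^ k = (1 - y) * (\<Sum>i<k. y ^ i)" for y :: bpoly and k by (rule one_diff_power_eq)
  have q1: "1 - qv ^ (2 * k) \<noteq> 0" if "0 < k" for k
    using qv_power_diff[of 0 "2 * k"] that by auto
  have W: "(\<Sum>i<n. qv ^ (2*i)) = (\<Sum>i<n'. R ^ i) * (\<Sum>i<g. (qv^2) ^ i)"
  proof -
    have "(1 - qv^2) * (\<Sum>i<n. qv ^ (2*i)) = 1 - R ^ n'"
      unfolding power_mult geo[symmetric] by (simp add: jn R flip: power_mult)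
    also have "\<dots> = (1 - R) * (\<Sum>i<n'. R ^ i)" by (rule geo)
    also have "1 - R = (1 - qv^2) * (\<Sum>i<g. (qv^2) ^ i)"
      unfolding R_def power_mult by (rule geo)
    finally have "(1 - qv^2) * (\<Sum>i<n. qv ^ (2*i)) = (1 - qv^2) * ((\<Sum>i<n'. R ^ i) * (\<Sum>i<g. (qv^2) ^ i))"
      by (simp only: mult_ac)
    then show ?thesis using q1[of 1] by simp
  qed
  have "coprime (\<Sum>i<j'. R ^ i) (\<Sum>i<n. qv ^ (2*i))"
  proof -
    have "(\<Sum>i<g. (qv^2) ^ i) dvd 1 - R"
      unfolding R_def power_mult geo[of "qv^2" g] by simp
    then have "coprime (\<Sum>i<j'. R ^ i) (\<Sum>i<g. (qv^2) ^ i)"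
      by (rule coprime_geometric_one_minus[OF g0(2)])
    with coprime_geometric[OF jn(3), of R] show ?thesis unfolding W by simp
  qed
  moreover have nz: "1 - R \<noteq> 0" "1 - R ^ j' \<noteq> 0"
    using q1[of g] q1[of j] g0 assms(1) by (simp_all add: R_def jn flip: power_mult mult.assoc)
  ultimately have "unit_at (\<Sum>i<n. qv ^ (2*i)) (to_fract (\<Sum>i<j'. R ^ i))"
    unfolding geo[of R j'] by (intro unit_at_to_fract) auto
  moreover have "(1 - (qR^2) ^ i) / (1 - (qR^2) ^ j) = to_fract (\<Sum>i<i'. R ^ i) / to_fract (\<Sum>i<j'. R ^ i)"
  proof -
    have "1 - (qR^2) ^ (g * k) = to_fract (1 - R) * to_fract (\<Sum>i<k. R ^ i)" for k
      unfolding qR_power R to_fract_mult[symmetric] geo[symmetric] by simp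
    moreover have "to_fract (1 - R) \<noteq> 0" unfolding to_fract_eq_0_iff by (rule nz(1))
    ultimately show ?thesis by (simp only: i' jn nonzero_mult_divide_mult_cancel_left not_False_eq_True)
  qed
  ultimately show ?thesis by (simp only: integral_at_divide integral_at_to_fract)
qed

lemma coprime_qint_poly:
  assumes "0 < n" "is_unit (coeff h j)"
  shows "(\<Sum>i<n. qv ^ (2*i)) \<noteq> 0" "coprime h (\<Sum>i<n. qv ^ (2*i))"
proof -
  have P: "(\<Sum>i<k. qv ^ (2*i)) = [:\<Sum>i<k. [:0, 1:] ^ (2*i):]" for k
    unfolding qv_power by (induction k) simp_all
  have "1 - (qv^2) ^ n \<noteq> 0"
    using qv_power_diff[of 0 "2 * n"] assms(1) by (auto simp flip: power_mult)
  then show "(\<Sum>i<n. qv ^ (2*i)) \<noteq> 0"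
    using one_diff_power_eq[of "qv^2" n] by (auto simp flip: power_mult)
  then show "coprime h (\<Sum>i<n. qv ^ (2*i))"
    using coprime_const_poly[of "\<Sum>i<n. [:0, 1:] ^ (2*i)" h j] assms(2) by (simp add: P coprime_commute)
qed

lemma weighted_sum_rcong_qint:
  fixes m :: nat
  defines "n \<equiv> 4*m+1"
  shows "rcong (weighted_sum qR aR m) (closed_form (qR^2) m * closing_factor qR aR) (\<Sum>i<n. qv ^ (2*i))"
proof -
  define P where "P = (\<Sum>i<n. qv ^ (2*i))"
  define Q where "Q = qR^2"
  have n: "0 < n" by (simp add: n_def)
  have Pg: "P = (\<Sum>i<n. (qv^2) ^ i)" by (simp add: P_def power_mult)
  have geo: "1 - y ^ k = (1 - y) * (\<Sum>i<k. y ^ i)" for y :: bpoly and k by (rule one_diff_power_eq)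
  have const: "coprime h P" if "is_unit (coeff h i)" for h i
    unfolding P_def using n that by (rule coprime_qint_poly)
  have cav: "coprime av P" "\<And>i. coprime (av - qv ^ i) P" "\<And>i. coprime (1 - av * qv ^ i) P"
    using const[of av 1] const[of "av - qv ^ _" 1] const[of "1 - av * qv ^ _" 0]
    by (simp_all only: coeff_linear) simp_all
  have ratio: "integral_at P ((1 - Q ^ i) / (1 - Q ^ j))" if "0 < j" "gcd j n dvd i" for i j
    unfolding P_def Q_def using that n by (intro integral_at_qint_ratio)
  have gen: "generic Q aR" unfolding Q_def by (rule generic_aR)
  have q1: "qR \<noteq> 1" using genericD(3)[OF gen] by (auto simp: Q_def)
  have uQ: "unit_at P Q"
    unfolding Q_def qR_eq to_fract_power[symmetric] Pg
    using coprime_power_geometric[OF n, of "qv^2" 1] by (intro unit_at_to_fract) (simp_all add: qv_def)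
  have uq: "unit_at P (1 - qR)"
  proof -
    have "1 - qv dvd 1 - qv^2" unfolding geo[of qv 2] by simp
    then have "coprime (1 - qv) P"
      unfolding Pg using coprime_geometric_one_minus[OF n, of "1 - qv" "qv^2"] by (simp add: coprime_commute)
    moreover have "1 - qv \<noteq> 0" by (simp add: qv_def one_pCons)
    ultimately have "unit_at P (to_fract (1 - qv))" by (intro unit_at_to_fract)
    then show ?thesis by (simp add: qR_eq)
  qed
  \<comment> \<open>1 / (1 + Q) = (1 - Q) / (1 - Q^2) is an admissible quotient because n is
    odd.\<close>
  have "gcd 2 n dvd 1" by (simp add: n_def)
  then have "integral_at P ((1 - Q ^ 1) / (1 - Q ^ 2))" by (intro ratio) simp_all
  moreover have "1 - Q^2 = (1 - Q) * (1 + Q)" by (simp add: power2_eq_square algebra_simps)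
  moreover have "1 - Q \<noteq> 0" "1 - Q^2 \<noteq> 0" using genericD(3)[OF gen] genericD(4)[OF gen, of 2] by auto
  ultimately have "unit_at P (1 + Q)"
    unfolding unit_at_def using unit_at_integral[OF uQ] by (auto intro!: integral_at_add)
  then have uD: "unit_at P ((1 - qR)^2 * (1 + qR^2))"
    using uq by (simp add: unit_at_mult unit_at_power flip: Q_def)
  have ua: "unit_at P aR" unfolding aR_eq using cav by (intro unit_at_to_fract) (simp_all add: av_def)
  have u: "unit_at P (1 - aR * Q ^ i)" "unit_at P (1 - Q ^ i / aR)" for i
    unfolding Q_def by (intro unit_at_linear_factors cav)+
  have qn: "qint Q n = to_fract P"
  proof -
    have "1 - Q ^ n = to_fract (1 - (qv^2) ^ n)"
      by (simp add: Q_def qR_eq to_fract_power)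
    also have "\<dots> = to_fract (1 - qv^2) * to_fract P"
      unfolding geo Pg by (rule to_fract_mult)
    also have "to_fract (1 - qv^2) = 1 - Q" by (simp add: Q_def qR_eq to_fract_power)
    finally have "1 - Q ^ n = (1 - Q) * to_fract P" .
    then show ?thesis using genericD(3)[OF gen] by (simp add: qint_def)
  qed
  have van: "rcong (qint Q n) 0 P"
    unfolding qn rcong_iff_integral by (rule exI[of _ 1]) simp
  have base: "integral_at P (qpoch Q (Q^4) m / qpoch (Q^4) (Q^4) m)"
    "rcong (base_sum Q aR m) (closed_form Q m) P"
    unfolding closed_form_def using gen uQ ua u ratio van unfolding n_def
    by (intro base_sum_rcong_qint; blast)+
  have "integral_at P (1 - Q ^ n / aR)"
    using unit_at_integral[OF u(2)] .
  then have "rcong (qint Q n * (1 - Q ^ n / aR)) 0 P" by (rule rcong_0_integral_mult[OF van])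
  moreover have "integral_at P (qint Q n)" unfolding qn by simp
  ultimately show ?thesis
    using weighted_sum_rcong[of qR aR P m "closed_form Q m"] gen q1 uQ ua u uD base
    by (simp add: Q_def n_def P_def)
qed

theorem theorem4:
  fixes n :: nat
  assumes "n > 0" and "n mod 4 = 1"
  shows "rcong
    (\<Sum>k = 0..(n - 1) div 4.
       qint (qR^2) (8*k+1) * (qint qR (8*k+1))^2 *
       ((qpoch (qR^2) (qR^8) k)^2 * qpoch (aR * qR^2) (qR^8) k * qpoch (qR^2 / aR) (qR^8) k) /
       ((qpoch (qR^8) (qR^8) k)^2 * qpoch (aR * qR^8) (qR^8) k * qpoch (qR^8 / aR) (qR^8) k) /
       qR ^ (4*k))
    (qint (qR^2) n * qpoch (qR^4) (qR^8) ((n - 1) div 4) / qpoch (qR^8) (qR^8) ((n - 1) div 4)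
       / qR ^ ((n - 1) div 2)
       * (1 - (1 - aR * qR^2) * (1 - qR^2 / aR) / ((1 - qR)^2 * (1 + qR^2))))
    ((\<Sum>i<n. qv ^ (2*i)) * (1 - av * qv ^ (2*n)) * (av - qv ^ (2*n)))"
proof -
  define m where "m = (n - 1) div 4"
  have n: "n = 4 * m + 1" using assms unfolding m_def by presburger
  have m: "(n - 1) div 4 = m" "(n - 1) div 2 = 2 * m" by (simp_all add: n)
  have *: "rcong (weighted_sum qR aR m) (closed_form (qR^2) m * closing_factor qR aR)
      ((\<Sum>i<n. qv ^ (2*i)) * (1 - av * qv ^ (2*n)) * (av - qv ^ (2*n)))"
  proof (intro rcong_coprime_mult)
    show "rcong (weighted_sum qR aR m) (closed_form (qR^2) m * closing_factor qR aR) (\<Sum>i<n. qv ^ (2*i))"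
      unfolding n by (rule weighted_sum_rcong_qint)
    show "rcong (weighted_sum qR aR m) (closed_form (qR^2) m * closing_factor qR aR) (av - qv ^ (2*n))"
      "rcong (weighted_sum qR aR m) (closed_form (qR^2) m * closing_factor qR aR) (1 - av * qv ^ (2*n))"
      unfolding n by (rule weighted_sum_rcong_linear_moduli)+
    have "coprime (1 - av * qv ^ (2*n)) (\<Sum>i<n. qv ^ (2*i))" "coprime (av - qv ^ (2*n)) (\<Sum>i<n. qv ^ (2*i))"
      using coprime_qint_poly(2)[OF assms(1), of "1 - av * qv ^ (2*n)" 0]
        coprime_qint_poly(2)[OF assms(1), of "av - qv ^ (2*n)" 1]
      by (simp_all only: coeff_linear) simp_all
    moreover have "coprime (av - qv ^ (2*n)) (1 - av * qv ^ (2*n))"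
      using assms(1) by (intro coprime_linear_reciprocal) simp
    ultimately show "coprime (\<Sum>i<n. qv ^ (2*i)) (1 - av * qv ^ (2*n))"
      "coprime ((\<Sum>i<n. qv ^ (2*i)) * (1 - av * qv ^ (2*n))) (av - qv ^ (2*n))"
      by (simp_all add: coprime_commute)
  qed
  \<comment> \<open>In particular Q^m = q^(2m) is the power q^((n-1)/2) of the claim.\<close>
  have "(qR^2)^4 = qR^8" "(qR^2)^2 = qR^4" "(qR^2)^m = qR ^ (2*m)"
    by (simp_all flip: power_mult)
  with * show ?thesis
    unfolding m weighted_sum_def closed_form_def closing_factor_def atLeast0AtMost n[symmetric] by simp
qed

end
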